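(* Let $\alpha>0$, $n\in\mathbb{N}$, and let $f$ be a real-valued $C^2$-function on $[0,\alpha)$. Let $g:(0,\alpha)\to\mathbb{R}$ be defined by $f(t)=t\,g(t)$. Then $g$ is a $C^2$-function on $(0,\alpha)$, and for any distinct $t_1,t_2,\dots,t_n\in(0,\alpha)$, $$[t_1,t_i,t_j]_f=t_1[t_1,t_i,t_j]_g+[t_i,t_j]_g\qquad(1\le i,j\le n).$$ Therefore, if $g$ is $n$-monotone and $n$-convex on $(0,\alpha)$, then $f$ is $n$-convex on $[0,\alpha)$.
   Context: Let $M_n$ be the algebra of $n\times n$ complex matrices and $I\subset\mathbb{R}$ an interval. A function $f:I\to\mathbb{R}$ is $n$-monotone on $I$ if $A\le B$ implies $f(A)\le f(B)$ for all selfadjoint $A,B\in M_n$ whose eigenvalues all lie in $I$ (functional calculus). It is $n$-convex on $I$ if $f(\lambda A+(1-\lambda)B)\le \lambda f(A)+(1-\lambda)f(B)$ for all $\lambda\in[0,1]$ and all selfadjoint $A,B\in M_n$ whose eigenvalues all lie in $I$. Divided differences of a $C^2$ function $h$: $[s,t]_h=\frac{h(s)-h(t)}{s-t}$ for $s\ne t$, $[s,s]_h=h'(s)$; $[s,t,u]_h=\frac{[s,t]_h-[t,u]_h}{s-u}$ if $s\neq u$; $[s,s,s]_h=\frac{h''(s)}{2}$. The divided difference is symmetric in its arguments, so $[s,t,s]_h$ with $s\ne t$ is understood as $[s,s,t]_h$. *)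

theory Defs
  imports "HOL-Analysis.Analysis" "Jordan_Normal_Form.Schur_Decomposition"
    "Jordan_Normal_Form.Spectral_Radius"
begin

text \<open>On an interval containing one of its end points, the derivative there is one-sided.\<close>

definition C2_on :: "real set \<Rightarrow> (real \<Rightarrow> real) \<Rightarrow> bool" where
  "C2_on S f \<longleftrightarrow> (\<exists>f' f''.
     (\<forall>x\<in>S. (f has_real_derivative f' x) (at x within S)) \<and>
     (\<forall>x\<in>S. (f' has_real_derivative f'' x) (at x within S)) \<and>
     continuous_on S f'')"

text \<open>Divided differences are only used at interior points of the domain of \<open>h\<close>, where
  \<^const>\<open>deriv\<close> is the (two-sided) derivative.\<close>

definition divdiff2 :: "(real \<Rightarrow> real) \<Rightarrow> real \<Rightarrow> real \<Rightarrow> real" where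
  "divdiff2 h s t = (if s = t then deriv h s else (h s - h t) / (s - t))"

text \<open>The third case is \<open>[s,t,s] = [s,s,t]\<close>, extending by symmetry.\<close>

definition divdiff3 :: "(real \<Rightarrow> real) \<Rightarrow> real \<Rightarrow> real \<Rightarrow> real \<Rightarrow> real" where
  "divdiff3 h s t u =
     (if s \<noteq> u then (divdiff2 h s t - divdiff2 h t u) / (s - u)
      else if s = t then deriv (deriv h) s / 2
      else (divdiff2 h s s - divdiff2 h s t) / (s - t))"

definition selfadjoint_mat :: "complex mat \<Rightarrow> bool" where
  "selfadjoint_mat A \<longleftrightarrow> mat_adjoint A = A"

definition unitary_mat :: "nat \<Rightarrow> complex mat \<Rightarrow> bool" where
  "unitary_mat n U \<longleftrightarrow> U \<in> carrier_mat n n \<and>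
     mat_adjoint U * U = 1\<^sub>m n \<and> U * mat_adjoint U = 1\<^sub>m n"

text \<open>The order on the complex numbers is the one of \<^theory>\<open>HOL-Library.Complex_Order\<close>:
  \<open>0 \<le> z\<close> means that \<open>z\<close> is real and nonnegative.\<close>

definition psd_mat :: "nat \<Rightarrow> complex mat \<Rightarrow> bool" where
  "psd_mat n A \<longleftrightarrow> A \<in> carrier_mat n n \<and> selfadjoint_mat A \<and>
     (\<forall>v\<in>carrier_vec n. 0 \<le> (A *\<^sub>v v) \<bullet>c v)"

definition loewner_le :: "nat \<Rightarrow> complex mat \<Rightarrow> complex mat \<Rightarrow> bool" where
  "loewner_le n A B \<longleftrightarrow> psd_mat n (B - A)"

text \<open>Functional calculus of a selfadjoint matrix: diagonalise by a unitary matrix and apply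
  \<open>f\<close> to the eigenvalues. The result does not depend on the diagonalisation; see
  \<open>mat_fun_eqI\<close> below.\<close>

definition mat_fun :: "(real \<Rightarrow> real) \<Rightarrow> complex mat \<Rightarrow> complex mat" where
  "mat_fun f A = (THE B. \<exists>U d. unitary_mat (dim_row A) U \<and>
     A = U * mat_diag (dim_row A) (\<lambda>i. complex_of_real (d i)) * mat_adjoint U \<and>
     B = U * mat_diag (dim_row A) (\<lambda>i. complex_of_real (f (d i))) * mat_adjoint U)"

definition selfadjoint_mats_on :: "nat \<Rightarrow> real set \<Rightarrow> complex mat set" where
  "selfadjoint_mats_on n I = {A \<in> carrier_mat n n.
     selfadjoint_mat A \<and> spectrum A \<subseteq> complex_of_real ` I}"

definition n_monotone_on :: "nat \<Rightarrow> real set \<Rightarrow> (real \<Rightarrow> real) \<Rightarrow> bool" where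
  "n_monotone_on n I f \<longleftrightarrow>
     (\<forall>A\<in>selfadjoint_mats_on n I. \<forall>B\<in>selfadjoint_mats_on n I.
        loewner_le n A B \<longrightarrow> loewner_le n (mat_fun f A) (mat_fun f B))"

definition n_convex_on :: "nat \<Rightarrow> real set \<Rightarrow> (real \<Rightarrow> real) \<Rightarrow> bool" where
  "n_convex_on n I f \<longleftrightarrow>
     (\<forall>A\<in>selfadjoint_mats_on n I. \<forall>B\<in>selfadjoint_mats_on n I. \<forall>l\<in>{0..1::real}.
        loewner_le n
          (mat_fun f (complex_of_real l \<cdot>\<^sub>m A + complex_of_real (1 - l) \<cdot>\<^sub>m B))
          (complex_of_real l \<cdot>\<^sub>m mat_fun f A + complex_of_real (1 - l) \<cdot>\<^sub>m mat_fun f B))"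

lemma mat_adjoint_carrier:
  "U \<in> carrier_mat n m \<Longrightarrow> mat_adjoint U \<in> carrier_mat m n"
  unfolding mat_adjoint_def by auto

lemma mat_diag_decomposition_unique:
  assumes U: "unitary_mat n U" and V: "unitary_mat n V"
    and eq: "U * mat_diag n (\<lambda>i. complex_of_real (d i)) * mat_adjoint U
           = V * mat_diag n (\<lambda>i. complex_of_real (e i)) * mat_adjoint V"
  shows "U * mat_diag n (\<lambda>i. complex_of_real (f (d i))) * mat_adjoint U
       = V * mat_diag n (\<lambda>i. complex_of_real (f (e i))) * mat_adjoint V"
proof -
  let ?D = "\<lambda>d. mat_diag n (\<lambda>i. complex_of_real (d i))"
  let ?U = "mat_adjoint U" and ?V = "mat_adjoint V"
  have c: "U \<in> carrier_mat n n" "V \<in> carrier_mat n n"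
    "?U \<in> carrier_mat n n" "?V \<in> carrier_mat n n"
    and u: "?U * U = 1\<^sub>m n" "U * ?U = 1\<^sub>m n" "?V * V = 1\<^sub>m n" "V * ?V = 1\<^sub>m n"
    using U V unfolding unitary_mat_def by (auto intro: mat_adjoint_carrier)
  have cD: "?D d \<in> carrier_mat n n" for d by simp
  note mult_carrier = mult_carrier_mat[of _ n n _ n] and assoc = assoc_mult_mat[of _ n n _ n _ n]
  define W where "W = ?V * U"
  have cW: "W \<in> carrier_mat n n" using c unfolding W_def by simp
  have conj: "W * ?D d = ?D e * W \<longleftrightarrow> U * ?D d * ?U = V * ?D e * ?V" for d e
  proof
    assume a: "U * ?D d * ?U = V * ?D e * ?V"
    have "W * ?D d = ?V * (U * ?D d * ?U) * U"
      unfolding W_def using c cD[of d] u(1)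
      by (simp add: assoc mult_carrier right_mult_one_mat[of _ n n])
    also have "\<dots> = ?V * (V * ?D e * ?V) * U" by (simp only: a)
    also have "\<dots> = (?V * V) * (?D e * (?V * U))"
      using c cD[of e] by (simp add: assoc mult_carrier)
    also have "\<dots> = ?D e * W"
      unfolding W_def u(3) by (rule left_mult_one_mat[where nc = n]) (use c cD[of e] in \<open>simp add: mult_carrier\<close>)
    finally show "W * ?D d = ?D e * W" .
  next
    assume a: "W * ?D d = ?D e * W"
    have "U * ?D d * ?U = (V * ?V) * (U * ?D d * ?U)"
      unfolding u(4) by (rule left_mult_one_mat[where nc = n, symmetric]) (use c cD[of d] in \<open>simp add: mult_carrier\<close>)
    also have "\<dots> = V * (W * ?D d) * ?U"
      unfolding W_def using c cD[of d] by (simp add: assoc mult_carrier)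
    also have "\<dots> = V * (?D e * W) * ?U" by (simp only: a)
    also have "\<dots> = V * ?D e * ?V"
      unfolding W_def using c cD[of e] u(2)
      by (simp add: assoc mult_carrier right_mult_one_mat[of _ n n])
    finally show "U * ?D d * ?U = V * ?D e * ?V" .
  qed
  have entries: "W * ?D d = ?D e * W \<longleftrightarrow>
      (\<forall>i<n. \<forall>j<n. W $$ (i,j) * complex_of_real (d j) = complex_of_real (e i) * W $$ (i,j))"
    for d e
    unfolding mat_diag_mult_right[OF cW] mat_diag_mult_left[OF cW]
    by (subst mat_eq_iff) auto
  have "W * ?D d = ?D e * W" using conj eq by simp
  then have *: "W $$ (i,j) * complex_of_real (d j) = complex_of_real (e i) * W $$ (i,j)"
    if "i < n" "j < n" for i j using entries that by blast
  have "W $$ (i,j) = 0 \<or> d j = e i" if "i < n" "j < n" for i j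
    using *[OF that] by (simp add: mult.commute)
  then have "W * ?D (\<lambda>i. f (d i)) = ?D (\<lambda>i. f (e i)) * W"
    unfolding entries by fastforce
  then show ?thesis using conj by simp
qed

lemma mat_fun_eqI:
  assumes U: "unitary_mat n U"
    and A: "A = U * mat_diag n (\<lambda>i. complex_of_real (d i)) * mat_adjoint U"
  shows "mat_fun f A = U * mat_diag n (\<lambda>i. complex_of_real (f (d i))) * mat_adjoint U"
proof -
  have "U \<in> carrier_mat n n" using U unfolding unitary_mat_def by blast
  then have n: "dim_row A = n" unfolding A by simp
  show ?thesis unfolding mat_fun_def n
  proof (rule the_equality)
    show "\<exists>V e. unitary_mat n V \<and>
        A = V * mat_diag n (\<lambda>i. complex_of_real (e i)) * mat_adjoint V \<and>
        U * mat_diag n (\<lambda>i. complex_of_real (f (d i))) * mat_adjoint U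
          = V * mat_diag n (\<lambda>i. complex_of_real (f (e i))) * mat_adjoint V"
      using U A by blast
  next
    fix B
    assume "\<exists>V e. unitary_mat n V \<and>
        A = V * mat_diag n (\<lambda>i. complex_of_real (e i)) * mat_adjoint V \<and>
        B = V * mat_diag n (\<lambda>i. complex_of_real (f (e i))) * mat_adjoint V"
    then obtain V e where V: "unitary_mat n V"
      and AV: "A = V * mat_diag n (\<lambda>i. complex_of_real (e i)) * mat_adjoint V"
      and B: "B = V * mat_diag n (\<lambda>i. complex_of_real (f (e i))) * mat_adjoint V" by blast
    show "B = U * mat_diag n (\<lambda>i. complex_of_real (f (d i))) * mat_adjoint U"
      unfolding B by (rule mat_diag_decomposition_unique[OF V U]) (simp only: A[symmetric] AV[symmetric])
  qed
qed

end

theory Submission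
  imports Defs
begin

text \<open>
  Both the smoothness of \<open>g\<close> and the identity between divided differences are direct calculations;
  the latter is the Leibniz rule for the product of the identity with \<open>g\<close>. The matrix inequality rests on
  the kernels \<open>N\<^sub>h(a; c)\<close> with entries
  \<open>h(a) - h(c\<^sub>i) - (a - c\<^sub>i) [c\<^sub>i, c\<^sub>j]\<^sub>h = (a - c\<^sub>i) (a - c\<^sub>j) [a, c\<^sub>i, c\<^sub>j]\<^sub>h\<close>,
  called \<open>interp_err\<close> below. Let \<open>C\<close> be selfadjoint with eigenvalues \<open>c\<^sub>i\<close> and eigenprojections \<open>Q\<^sub>i\<close>,
  and \<open>A\<close> with eigenvalues \<open>a\<^sub>k\<close> and eigenprojections \<open>P\<^sub>k\<close>. Then there is the exact formula
  \<open>h(A) = h(C) + Dh(C)(A - C) + (\<Sum>k i j. N\<^sub>h(a\<^sub>k; c)\<^sub>i\<^sub>j Q\<^sub>i P\<^sub>k Q\<^sub>j)\<close>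
  with \<open>Dh(C)(X) = (\<Sum>i j. [c\<^sub>i, c\<^sub>j]\<^sub>h Q\<^sub>i X Q\<^sub>j)\<close>; in the language of quadratic forms this is
  \<open>quad_form_expansion\<close>. It is used three times.

  First, if all kernels \<open>N\<^sub>f(a; c)\<close> with \<open>a\<close> and \<open>c\<close> in the interval are positive, then \<open>f\<close> is
  \<open>n\<close>-convex, because the first-order term is linear and cancels in a convex combination
  (\<open>n_convex_onI_kernel\<close>).

  Secondly, for a matrix \<open>A\<close> near \<open>C\<close> the last sum is of second order (\<open>quad_form_perturbation\<close>), which
  gives the derivative of the functional calculus. So \<open>n\<close>-monotonicity of \<open>g\<close> implies that the
  Loewner matrices \<open>[c\<^sub>i, c\<^sub>j]\<^sub>g\<close> are positive (\<open>n_monotone_on_pos_kernel\<close>), and \<open>n\<close>-convexity of \<open>g\<close>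
  implies the gradient inequality \<open>g(A) \<ge> g(C) + Dg(C)(A - C)\<close>.

  Thirdly, by the exact formula the gradient inequality says that the sum of the terms with
  \<open>N\<^sub>g(a\<^sub>k; c)\<close> is positive. For suitable matrices \<open>A\<close> with eigenvalues \<open>a, c\<^sub>2, \<dots>, c\<^sub>n\<close> all but one of
  these terms become negligible, so each \<open>N\<^sub>g(a; c)\<close> is positive (\<open>n_convex_on_pos_kernel\<close>).

  The Leibniz rule gives \<open>N\<^sub>f(a; c)\<^sub>i\<^sub>j = a N\<^sub>g(a; c)\<^sub>i\<^sub>j + (a - c\<^sub>i) (a - c\<^sub>j) [c\<^sub>i, c\<^sub>j]\<^sub>g\<close>, and both
  summands are positive kernels (\<open>pos_kernel_times_id\<close>). The necessary conditions on \<open>g\<close> concern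
  distinct interior nodes; positivity of \<open>N\<^sub>f\<close> extends to all nodes in the half-open interval by
  continuity (\<open>pos_kernel_endpoint\<close>).
\<close>

(* The dollar sign denotes the entries of the matrix library's vectors throughout. *)
no_notation vec_nth (infixl \<open>$\<close> 90)

section \<open>Adjoints and the spectral theorem\<close>

lemma mat_adjoint_dim [simp]:
  "dim_row (mat_adjoint A) = dim_col A" "dim_col (mat_adjoint A) = dim_row A"
  unfolding mat_adjoint_def by auto

lemma mat_adjoint_index [simp]:
  fixes A :: "complex mat"
  assumes "i < dim_col A" "j < dim_row A"
  shows "mat_adjoint A $$ (i, j) = cnj (A $$ (j, i))"
  using assms unfolding mat_adjoint_def by (simp add: mat_of_rows_index conjugate_complex_def)

lemma mat_adjoint_mult:
  fixes A B :: "complex mat"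
  assumes "A \<in> carrier_mat n m" "B \<in> carrier_mat m k"
  shows "mat_adjoint (A * B) = mat_adjoint B * mat_adjoint A"
  using assms by (intro eq_matI) (auto simp: scalar_prod_def mult.commute)

lemma mat_adjoint_adjoint:
  fixes A :: "complex mat"
  shows "mat_adjoint (mat_adjoint A) = A"
  by (rule eq_matI) auto

lemma selfadjoint_mat_iff:
  assumes "A \<in> carrier_mat n n"
  shows "selfadjoint_mat A \<longleftrightarrow> (\<forall>i<n. \<forall>j<n. A $$ (i, j) = cnj (A $$ (j, i)))"
proof -
  have "mat_adjoint A $$ (i, j) = cnj (A $$ (j, i))" if "i < n" "j < n" for i j
    using assms that by simp
  moreover have "mat_adjoint A \<in> carrier_mat n n" using assms by (rule mat_adjoint_carrier)
  ultimately show ?thesis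
    using assms unfolding selfadjoint_mat_def mat_eq_iff by (metis carrier_matD)
qed

lemma unitary_matI:
  assumes "U \<in> carrier_mat n n" "mat_adjoint U * U = 1\<^sub>m n"
  shows "unitary_mat n U"
  using assms mat_mult_left_right_inverse[of "mat_adjoint U" n U] mat_adjoint_carrier[of U n n]
  unfolding unitary_mat_def by auto

lemma unitary_mat_mult:
  assumes "unitary_mat n U" "unitary_mat n V"
  shows "unitary_mat n (U * V)"
proof (rule unitary_matI)
  have c: "U \<in> carrier_mat n n" "V \<in> carrier_mat n n"
      "mat_adjoint U \<in> carrier_mat n n" "mat_adjoint V \<in> carrier_mat n n"
    using assms by (auto simp: unitary_mat_def intro: mat_adjoint_carrier)
  then show "U * V \<in> carrier_mat n n" by simp
  have "mat_adjoint (U * V) * (U * V) = mat_adjoint V * ((mat_adjoint U * U) * V)"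
    unfolding mat_adjoint_mult[OF c(1,2)] using c by (simp add: assoc_mult_mat[of _ n n _ n _ n])
  also have "\<dots> = 1\<^sub>m n" using assms c by (simp add: unitary_mat_def)
  finally show "mat_adjoint (U * V) * (U * V) = 1\<^sub>m n" .
qed

text \<open>The Gram-Schmidt basis is orthogonal but not normalised; the columns of the unitary matrix
  are its rescaled vectors.\<close>

lemma unitary_with_eigenvector:
  fixes A :: "complex mat"
  assumes A: "A \<in> carrier_mat n n" and n: "n > 0"
  obtains U e where "unitary_mat n U" "\<And>i. i < n \<Longrightarrow> (A * U) $$ (i, 0) = e * U $$ (i, 0)"
proof -
  obtain e where "e \<in> spectrum A" using spectrum_non_empty[OF A] n by auto
  then obtain v where "eigenvector A v e" unfolding spectrum_def eigenvalue_def by auto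
  then have v: "v \<in> carrier_vec n" "v \<noteq> 0\<^sub>v n" and Av: "A *\<^sub>v v = e \<cdot>\<^sub>v v"
    using A unfolding eigenvector_def by auto
  interpret cof_vec_space n "TYPE(complex)" .
  let ?b = "basis_completion v"
  from basis_completion[OF v]
  have b: "distinct ?b" "\<not> lin_dep (set ?b)" "set ?b \<subseteq> carrier_vec n" "hd ?b = v" "length ?b = n"
    by auto
  then obtain vs where bv: "?b = v # vs" using n by (cases ?b) auto
  define ws where "ws = gram_schmidt n ?b"
  have ws: "set ws \<subseteq> carrier_vec n" "corthogonal ws" "length ws = n"
    using gram_schmidt_result[OF b(3,1,2) refl] b(5) by (auto simp: ws_def)
  have hd: "hd ws = v" unfolding ws_def bv using gram_schmidt_hd[OF v(1), of vs] by simp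
  then have ws0: "ws ! 0 = v" using ws(3) n by (metis hd_conv_nth length_0_conv less_numeral_extra(3))
  define r where "r j = sqrt (\<Sum>i<n. (cmod (ws ! j $ i))\<^sup>2)" for j
  have ip: "ws ! j \<bullet>c ws ! k = (\<Sum>i<n. ws ! j $ i * cnj (ws ! k $ i))" if "j < n" "k < n" for j k
  proof -
    have "ws ! k \<in> carrier_vec n" using ws that by auto
    then show ?thesis by (simp add: scalar_prod_def conjugate_complex_def atLeast0LessThan)
  qed
  have r2: "ws ! j \<bullet>c ws ! j = complex_of_real (r j ^ 2)" if "j < n" for j
    unfolding ip[OF that that] r_def
    by (simp add: sum_nonneg complex_norm_square[symmetric] flip: of_real_power)
  have r0: "r j \<noteq> 0" if "j < n" for j
    using corthogonalD[OF ws(2), of j j] that ws(3) r2[OF that] by auto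
  define U where "U = Matrix.mat n n (\<lambda>(i, j). ws ! j $ i / complex_of_real (r j))"
  have U: "U \<in> carrier_mat n n" by (simp add: U_def)
  have "mat_adjoint U * U = 1\<^sub>m n"
  proof (rule eq_matI)
    fix j k assume jk: "j < dim_row (1\<^sub>m n :: complex mat)" "k < dim_col (1\<^sub>m n :: complex mat)"
    then have jk: "j < n" "k < n" by auto
    have "(mat_adjoint U * U) $$ (j, k) = (\<Sum>i<n. cnj (U $$ (i, j)) * U $$ (i, k))"
      using U jk by (simp add: scalar_prod_def atLeast0LessThan)
    also have "\<dots> = (ws ! k \<bullet>c ws ! j) / (r j * r k)"
      using jk by (simp add: U_def ip sum_divide_distrib mult_ac)
    also have "\<dots> = 1\<^sub>m n $$ (j, k)"
    proof (cases "j = k")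
      case True
      then show ?thesis using r2[OF jk(2)] r0[OF jk(2)] jk by (simp add: power2_eq_square)
    next
      case False
      then show ?thesis using corthogonalD[OF ws(2), of k j] jk ws(3) by simp
    qed
    finally show "(mat_adjoint U * U) $$ (j, k) = 1\<^sub>m n $$ (j, k)" .
  qed (use U in auto)
  then have "unitary_mat n U" by (rule unitary_matI[OF U])
  moreover have "(A * U) $$ (i, 0) = e * U $$ (i, 0)" if "i < n" for i
  proof -
    have "(A *\<^sub>v v) $ i = e * v $ i" using Av v that by simp
    then have "(\<Sum>k<n. A $$ (i, k) * v $ k) = e * v $ i"
      using A v that by (simp add: scalar_prod_def atLeast0LessThan)
    then show ?thesis using A U n that
      by (simp add: scalar_prod_def atLeast0LessThan U_def ws0 sum_divide_distrib[symmetric])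
  qed
  ultimately show ?thesis by (rule that)
qed

lemma block_diag_mult:
  fixes A B C D :: "'a :: comm_ring_1 mat"
  assumes "A \<in> carrier_mat k k" "B \<in> carrier_mat k k" "C \<in> carrier_mat n n" "D \<in> carrier_mat n n"
  shows "four_block_mat A (0\<^sub>m k n) (0\<^sub>m n k) C * four_block_mat B (0\<^sub>m k n) (0\<^sub>m n k) D
    = four_block_mat (A * B) (0\<^sub>m k n) (0\<^sub>m n k) (C * D)"
  using assms by (subst mult_four_block_mat[of _ k k _ n _ n _ _ k _ n]) auto

text \<open>By induction on the dimension: in an orthonormal basis whose first vector is an eigenvector, a
  selfadjoint matrix is block diagonal with a real \<open>1 \<times> 1\<close> block.\<close>

theorem spectral_theorem:
  assumes "A \<in> carrier_mat n n" "selfadjoint_mat A"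
  shows "\<exists>U d. unitary_mat n U \<and> A = U * mat_diag n (\<lambda>i. complex_of_real (d i)) * mat_adjoint U"
  using assms
proof (induction n arbitrary: A)
  case 0
  then have "A = 1\<^sub>m 0 * mat_diag 0 (\<lambda>i. complex_of_real 0) * mat_adjoint (1\<^sub>m 0)"
    by (intro eq_matI) auto
  moreover have "unitary_mat 0 (1\<^sub>m 0)" by (rule unitary_matI) auto
  ultimately show ?case by (intro exI[of _ "1\<^sub>m 0"] exI[of _ "\<lambda>_. 0"] conjI)
next
  case (Suc n A)
  note A = Suc.prems(1)
  obtain U e where U: "unitary_mat (Suc n) U"
    and ev: "\<And>i. i < Suc n \<Longrightarrow> (A * U) $$ (i, 0) = e * U $$ (i, 0)"
    using unitary_with_eigenvector[OF A] by blast
  let ?U = "mat_adjoint U"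
  have c: "U \<in> carrier_mat (Suc n) (Suc n)" "?U \<in> carrier_mat (Suc n) (Suc n)"
    and u: "?U * U = 1\<^sub>m (Suc n)" "U * ?U = 1\<^sub>m (Suc n)"
    using U by (auto simp: unitary_mat_def intro: mat_adjoint_carrier)
  define A' where "A' = ?U * (A * U)"
  have A': "A' \<in> carrier_mat (Suc n) (Suc n)" unfolding A'_def using c A by auto
  have "mat_adjoint A' = A'"
  proof -
    have "mat_adjoint A' = (?U * A) * U"
      unfolding A'_def using A c Suc.prems(2)
      by (simp add: mat_adjoint_mult[of _ "Suc n" "Suc n" _ "Suc n"] mat_adjoint_adjoint selfadjoint_mat_def)
    then show ?thesis unfolding A'_def using c A by (simp add: assoc_mult_mat[of _ "Suc n" "Suc n" _ "Suc n"])
  qed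
  then have sa: "A' $$ (i, j) = cnj (A' $$ (j, i))" if "i < Suc n" "j < Suc n" for i j
    using selfadjoint_mat_iff[OF A', unfolded selfadjoint_mat_def] that by blast
  have col0: "A' $$ (i, 0) = (if i = 0 then e else 0)" if i: "i < Suc n" for i
  proof -
    have "A' $$ (i, 0) = (\<Sum>k<Suc n. ?U $$ (i, k) * (A * U) $$ (k, 0))"
      unfolding A'_def using c A i by (simp add: scalar_prod_def atLeast0LessThan del: sum.lessThan_Suc)
    also have "\<dots> = e * (\<Sum>k<Suc n. ?U $$ (i, k) * U $$ (k, 0))"
      unfolding sum_distrib_left by (rule sum.cong) (simp_all add: ev)
    also have "(\<Sum>k<Suc n. ?U $$ (i, k) * U $$ (k, 0)) = (?U * U) $$ (i, 0)"
      using c i by (simp add: scalar_prod_def atLeast0LessThan del: sum.lessThan_Suc)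
    finally show ?thesis using i unfolding u by simp
  qed
  have "e = cnj e" using sa[of 0 0] col0[of 0] by (metis zero_less_Suc)
  then have e: "e = complex_of_real (Re e)"
    by (metis Reals_cnj_iff of_real_Re)
  define A3 where "A3 = Matrix.mat n n (\<lambda>(i, j). A' $$ (Suc i, Suc j))"
  have A3: "A3 \<in> carrier_mat n n" by (simp add: A3_def)
  have "selfadjoint_mat A3"
    unfolding selfadjoint_mat_iff[OF A3]
  proof (intro allI impI)
    fix i j assume "i < n" "j < n"
    moreover from this have "A' $$ (Suc i, Suc j) = cnj (A' $$ (Suc j, Suc i))"
      by (intro sa) auto
    ultimately show "A3 $$ (i, j) = cnj (A3 $$ (j, i))" by (simp only: A3_def index_mat split)
  qed
  then obtain P d where P: "unitary_mat n P"
    and A3P: "A3 = P * mat_diag n (\<lambda>i. complex_of_real (d i)) * mat_adjoint P"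
    using Suc.IH[OF A3] by blast
  have cP: "P \<in> carrier_mat n n" "mat_adjoint P \<in> carrier_mat n n"
    using P by (auto simp: unitary_mat_def intro: mat_adjoint_carrier)
  define d' where "d' = case_nat (Re e) d"
  define V where "V = four_block_mat (1\<^sub>m 1) (0\<^sub>m 1 n) (0\<^sub>m n 1) P"
  have V: "V \<in> carrier_mat (Suc n) (Suc n)" 
    unfolding V_def using four_block_carrier_mat[of "1\<^sub>m 1" 1 1 P n n] cP by simp
  have aV: "mat_adjoint V = four_block_mat (1\<^sub>m 1) (0\<^sub>m 1 n) (0\<^sub>m n 1) (mat_adjoint P)"
  proof (rule eq_matI)
    fix i j
    assume "i < dim_row (four_block_mat (1\<^sub>m 1) (0\<^sub>m 1 n) (0\<^sub>m n 1) (mat_adjoint P))"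
      "j < dim_col (four_block_mat (1\<^sub>m 1) (0\<^sub>m 1 n) (0\<^sub>m n 1) (mat_adjoint P))"
    then have "i < Suc n" "j < Suc n" using cP by auto
    then show "mat_adjoint V $$ (i, j)
        = four_block_mat (1\<^sub>m 1) (0\<^sub>m 1 n) (0\<^sub>m n 1) (mat_adjoint P) $$ (i, j)"
      using cP V by (cases i; cases j) (simp_all add: V_def)
  qed (use cP V in auto)
  have "mat_adjoint V * V = 1\<^sub>m (Suc n)"
    unfolding aV unfolding V_def
    using block_diag_mult[of "1\<^sub>m 1" 1 "1\<^sub>m 1" "mat_adjoint P" n P] cP P
    by (simp add: unitary_mat_def)
  then have uV: "unitary_mat (Suc n) V" by (rule unitary_matI[OF V])
  let ?D = "mat_diag n (\<lambda>i. complex_of_real (d i))" and ?D' = "mat_diag (Suc n) (\<lambda>i. complex_of_real (d' i))"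
  have D': "?D' = four_block_mat (mat_diag 1 (\<lambda>i. e)) (0\<^sub>m 1 n) (0\<^sub>m n 1) ?D"
  proof (rule eq_matI)
    fix i j
    assume "i < dim_row (four_block_mat (mat_diag 1 (\<lambda>i. e)) (0\<^sub>m 1 n) (0\<^sub>m n 1) ?D)"
      "j < dim_col (four_block_mat (mat_diag 1 (\<lambda>i. e)) (0\<^sub>m 1 n) (0\<^sub>m n 1) ?D)"
    then have "i < Suc n" "j < Suc n" by (auto simp: mat_diag_def)
    then show "?D' $$ (i, j) = four_block_mat (mat_diag 1 (\<lambda>i. e)) (0\<^sub>m 1 n) (0\<^sub>m n 1) ?D $$ (i, j)"
      using e by (cases i; cases j) (simp_all add: mat_diag_def d'_def)
  qed (auto simp: mat_diag_def)
  have "V * ?D' * mat_adjoint V = four_block_mat (mat_diag 1 (\<lambda>i. e)) (0\<^sub>m 1 n) (0\<^sub>m n 1) A3"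
    unfolding aV D' A3P unfolding V_def
    using cP block_diag_mult[of "1\<^sub>m 1" 1 "mat_diag 1 (\<lambda>i. e)" P n ?D]
      block_diag_mult[of "mat_diag 1 (\<lambda>i. e)" 1 "1\<^sub>m 1" "P * ?D" n "mat_adjoint P"]
      mat_diag_dim[of 1 "\<lambda>i. e"]
    by (simp del: One_nat_def)
  also have "\<dots> = A'"
  proof (rule eq_matI)
    fix i j assume "i < dim_row A'" "j < dim_col A'"
    then have ij: "i < Suc n" "j < Suc n" using A' by auto
    then show "four_block_mat (mat_diag 1 (\<lambda>i. e)) (0\<^sub>m 1 n) (0\<^sub>m n 1) A3 $$ (i, j) = A' $$ (i, j)"
      using col0[OF ij(1)] col0[OF ij(2)] sa[of 0 j]
      by (cases i; cases j) (simp_all add: A3_def mat_diag_def)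
  qed (use A' in \<open>auto simp: A3_def mat_diag_def\<close>)
  finally have A'V: "A' = V * ?D' * mat_adjoint V" ..
  have "U * V * ?D' * mat_adjoint (U * V) = U * (V * ?D' * mat_adjoint V) * ?U"
    using c V mat_diag_dim[of "Suc n" "\<lambda>i. complex_of_real (d' i)"] mat_adjoint_carrier[OF V]
    by (simp add: mat_adjoint_mult[OF c(1) V] assoc_mult_mat[of _ "Suc n" "Suc n" _ "Suc n" _ "Suc n"]
          mult_carrier_mat[of _ "Suc n" "Suc n" _ "Suc n"])
  also have "\<dots> = (U * ?U) * A * (U * ?U)"
    unfolding A'V[symmetric] A'_def using c A
    by (simp add: assoc_mult_mat[of _ "Suc n" "Suc n" _ "Suc n" _ "Suc n"]
          mult_carrier_mat[of _ "Suc n" "Suc n" _ "Suc n"])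
  also have "\<dots> = A" unfolding u using A by simp
  finally show ?case using unitary_mat_mult[OF U uV] by metis
qed

section \<open>Functional calculus of a diagonalised matrix\<close>

text \<open>The selfadjoint matrix with eigenvalues \<open>d 0, \<dots>, d (n - 1)\<close> whose eigenvectors are the columns
  of \<open>U\<close>.\<close>

definition diag_conj :: "nat \<Rightarrow> complex mat \<Rightarrow> (nat \<Rightarrow> real) \<Rightarrow> complex mat" where
  "diag_conj n U d = U * mat_diag n (\<lambda>i. complex_of_real (d i)) * mat_adjoint U"

lemma unitary_matD:
  assumes "unitary_mat n U"
  shows "U \<in> carrier_mat n n" "mat_adjoint U \<in> carrier_mat n n"
    "mat_adjoint U * U = 1\<^sub>m n" "U * mat_adjoint U = 1\<^sub>m n"
  using assms by (auto simp: unitary_mat_def intro: mat_adjoint_carrier)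

lemma unitary_mat_adjoint: "unitary_mat n U \<Longrightarrow> unitary_mat n (mat_adjoint U)"
  by (auto simp: unitary_mat_def mat_adjoint_adjoint intro: mat_adjoint_carrier)

lemma diag_conj_carrier [simp]: "U \<in> carrier_mat n n \<Longrightarrow> diag_conj n U d \<in> carrier_mat n n"
  unfolding diag_conj_def carrier_mat_def by auto

lemma diag_conj_index:
  assumes U: "U \<in> carrier_mat n n" and ij: "i < n" "j < n"
  shows "diag_conj n U d $$ (i, j) = (\<Sum>k<n. complex_of_real (d k) * U $$ (i, k) * cnj (U $$ (j, k)))"
proof -
  have "diag_conj n U d $$ (i, j) = (\<Sum>k<n. U $$ (i, k) * complex_of_real (d k) * mat_adjoint U $$ (k, j))"
    unfolding diag_conj_def mat_diag_mult_right[OF U] using U ij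
    by (simp add: scalar_prod_def atLeast0LessThan)
  also have "\<dots> = (\<Sum>k<n. complex_of_real (d k) * U $$ (i, k) * cnj (U $$ (j, k)))"
    by (rule sum.cong) (use U ij in simp_all)
  finally show ?thesis .
qed

lemma selfadjoint_diag_conj:
  assumes U: "U \<in> carrier_mat n n"
  shows "selfadjoint_mat (diag_conj n U d)"
proof -
  have "diag_conj n U d $$ (i, j) = cnj (diag_conj n U d $$ (j, i))" if "i < n" "j < n" for i j
    unfolding diag_conj_index[OF U that] diag_conj_index[OF U that(2,1)]
    by (simp add: cnj_sum mult_ac)
  then show ?thesis unfolding selfadjoint_mat_iff[OF diag_conj_carrier[OF U]] by blast
qed

lemma mat_fun_diag_conj:
  "unitary_mat n U \<Longrightarrow> mat_fun f (diag_conj n U d) = diag_conj n U (\<lambda>i. f (d i))"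
  unfolding diag_conj_def by (rule mat_fun_eqI[OF _ refl])

lemma quadratic_form_eq_sum:
  fixes A :: "complex mat"
  assumes "A \<in> carrier_mat n n" "v \<in> carrier_vec n"
  shows "(A *\<^sub>v v) \<bullet>c v = (\<Sum>i<n. \<Sum>j<n. A $$ (i, j) * v $ j * cnj (v $ i))"
  using assms by (simp add: scalar_prod_def conjugate_complex_def atLeast0LessThan sum_distrib_right)

lemma sum_rotate3:
  "(\<Sum>i\<in>A. \<Sum>j\<in>B. \<Sum>k\<in>C. F i j k) = (\<Sum>k\<in>C. \<Sum>i\<in>A. \<Sum>j\<in>B. F i j k)"
  by (simp add: sum.swap[of _ C B] sum.swap[of _ C A])

lemma quadratic_form_diag_conj:
  assumes U: "U \<in> carrier_mat n n" and v: "v \<in> carrier_vec n"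
  shows "(diag_conj n U d *\<^sub>v v) \<bullet>c v
    = complex_of_real (\<Sum>k<n. d k * (cmod ((mat_adjoint U *\<^sub>v v) $ k))\<^sup>2)"
proof -
  have "(diag_conj n U d *\<^sub>v v) \<bullet>c v
      = (\<Sum>i<n. \<Sum>j<n. \<Sum>k<n. complex_of_real (d k) * ((cnj (U $$ (j, k)) * v $ j) * cnj (cnj (U $$ (i, k)) * v $ i)))"
    unfolding quadratic_form_eq_sum[OF diag_conj_carrier[OF U] v]
    by (intro sum.cong refl) (simp add: diag_conj_index[OF U] sum_distrib_left sum_distrib_right mult_ac)
  also have "\<dots> = (\<Sum>k<n. \<Sum>i<n. \<Sum>j<n. complex_of_real (d k) * ((cnj (U $$ (j, k)) * v $ j) * cnj (cnj (U $$ (i, k)) * v $ i)))"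
    by (rule sum_rotate3)
  also have "\<dots> = (\<Sum>k<n. complex_of_real (d k) * ((\<Sum>j<n. cnj (U $$ (j, k)) * v $ j) * cnj (\<Sum>j<n. cnj (U $$ (j, k)) * v $ j)))"
    by (simp add: sum_product cnj_sum sum_distrib_left mult_ac)
  also have "\<dots> = (\<Sum>k<n. complex_of_real (d k) * complex_of_real ((cmod ((mat_adjoint U *\<^sub>v v) $ k))\<^sup>2))"
  proof (intro sum.cong refl)
    fix k assume "k \<in> {..<n}"
    then have "(mat_adjoint U *\<^sub>v v) $ k = (\<Sum>j<n. cnj (U $$ (j, k)) * v $ j)"
      using U v by (simp add: scalar_prod_def atLeast0LessThan)
    then show "complex_of_real (d k) * ((\<Sum>j<n. cnj (U $$ (j, k)) * v $ j) * cnj (\<Sum>j<n. cnj (U $$ (j, k)) * v $ j))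
        = complex_of_real (d k) * complex_of_real ((cmod ((mat_adjoint U *\<^sub>v v) $ k))\<^sup>2)"
      by (simp only: complex_norm_square)
  qed
  also have "\<dots> = complex_of_real (\<Sum>k<n. d k * (cmod ((mat_adjoint U *\<^sub>v v) $ k))\<^sup>2)" by simp
  finally show ?thesis .
qed

lemma diag_conj_compress:
  assumes "U \<in> carrier_mat n n" "V \<in> carrier_mat n n"
  shows "mat_adjoint V * diag_conj n U d * V = diag_conj n (mat_adjoint V * U) d"
  using assms mat_adjoint_carrier[OF assms(1)] mat_adjoint_carrier[OF assms(2)]
    mat_diag_dim[of n "\<lambda>i. complex_of_real (d i)"]
  unfolding diag_conj_def
  by (simp add: mat_adjoint_mult[of _ n n _ n] mat_adjoint_adjoint assoc_mult_mat[of _ n n _ n _ n]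
        mult_carrier_mat[of _ n n _ n])

lemma spectrum_diag_conj:
  assumes U: "unitary_mat n U"
  shows "spectrum (diag_conj n U d) = complex_of_real ` d ` {..<n}"
proof -
  note c = unitary_matD[OF U]
  let ?D = "mat_diag n (\<lambda>i. complex_of_real (d i))"
  have D: "?D \<in> carrier_mat n n" by simp
  have "similar_mat_wit (diag_conj n U d) ?D U (mat_adjoint U)"
    by (rule similar_mat_witI[OF c(4,3) _ diag_conj_carrier[OF c(1)] D c(1,2)]) (simp add: diag_conj_def)
  then have "char_poly (diag_conj n U d) = char_poly ?D"
    by (intro char_poly_similar) (auto simp: similar_mat_def)
  also have "\<dots> = (\<Prod>a\<leftarrow>diag_mat ?D. [:- a, 1:])"
    by (rule char_poly_upper_triangular[OF D]) (auto simp: mat_diag_def)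
  finally have "spectrum (diag_conj n U d) = set (diag_mat ?D)"
    using spectrum_root_char_poly[OF diag_conj_carrier[OF c(1)], of d]
    by (auto simp: poly_prod_list prod_list_zero_iff)
  also have "\<dots> = complex_of_real ` d ` {..<n}"
    by (auto simp: diag_mat_def mat_diag_def image_iff)
  finally show ?thesis .
qed

lemma diag_conj_mem_selfadjoint_mats_on:
  assumes "unitary_mat n U"
  shows "diag_conj n U d \<in> selfadjoint_mats_on n I \<longleftrightarrow> d ` {..<n} \<subseteq> I"
  using spectrum_diag_conj[OF assms, of d] diag_conj_carrier[OF unitary_matD(1)[OF assms]]
    selfadjoint_diag_conj[OF unitary_matD(1)[OF assms]]
    inj_image_subset_iff[OF inj_of_real, of "d ` {..<n}" I]
  by (simp add: selfadjoint_mats_on_def)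

lemma selfadjoint_mats_onE:
  assumes "A \<in> selfadjoint_mats_on n I"
  obtains U d where "unitary_mat n U" "A = diag_conj n U d" "\<And>k. k < n \<Longrightarrow> d k \<in> I"
proof -
  obtain U d where "unitary_mat n U" "A = diag_conj n U d"
    using spectral_theorem[of A n] assms by (auto simp: selfadjoint_mats_on_def diag_conj_def)
  moreover from this have "d ` {..<n} \<subseteq> I"
    using diag_conj_mem_selfadjoint_mats_on assms by blast
  ultimately show ?thesis by (intro that) auto
qed

section \<open>Quadratic forms and the Loewner order\<close>

text \<open>The real part is harmless for the matrices considered here: the quadratic form of a
  selfadjoint matrix is real. Taking it makes the Loewner order an inequality between reals.\<close>

definition quad_form :: "complex mat \<Rightarrow> complex vec \<Rightarrow> real" where
  "quad_form A v = Re ((A *\<^sub>v v) \<bullet>c v)"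

lemma quad_form_eq_sum:
  assumes "A \<in> carrier_mat n n" "v \<in> carrier_vec n"
  shows "quad_form A v = (\<Sum>i<n. \<Sum>j<n. Re (A $$ (i, j) * v $ j * cnj (v $ i)))"
  unfolding quad_form_def quadratic_form_eq_sum[OF assms] by (simp only: Re_sum)

lemma quad_form_diag_conj:
  assumes "U \<in> carrier_mat n n" "v \<in> carrier_vec n"
  shows "quad_form (diag_conj n U d) v = (\<Sum>k<n. d k * (cmod ((mat_adjoint U *\<^sub>v v) $ k))\<^sup>2)"
  unfolding quad_form_def quadratic_form_diag_conj[OF assms] by (rule Re_complex_of_real)

lemma quad_form_add:
  assumes "A \<in> carrier_mat n n" "B \<in> carrier_mat n n" "v \<in> carrier_vec n"
  shows "quad_form (A + B) v = quad_form A v + quad_form B v"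
  using assms by (simp add: quad_form_eq_sum[of _ n] ring_distribs sum.distrib)

lemma quad_form_diff:
  assumes "A \<in> carrier_mat n n" "B \<in> carrier_mat n n" "v \<in> carrier_vec n"
  shows "quad_form (A - B) v = quad_form A v - quad_form B v"
proof -
  have "A - B \<in> carrier_mat n n" using assms(2) by (rule minus_carrier_mat)
  then show ?thesis
    using assms by (simp add: quad_form_eq_sum[of _ n] ring_distribs sum_subtractf)
qed

lemma quad_form_smult:
  assumes "A \<in> carrier_mat n n" "v \<in> carrier_vec n"
  shows "quad_form (complex_of_real l \<cdot>\<^sub>m A) v = l * quad_form A v"
  using assms by (simp add: quad_form_eq_sum[of _ n] sum_distrib_left mult.assoc)

lemma selfadjoint_mat_add:
  assumes A: "A \<in> carrier_mat n n" "selfadjoint_mat A" and B: "B \<in> carrier_mat n n" "selfadjoint_mat B"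
  shows "selfadjoint_mat (A + B)"
proof -
  have "(A + B) $$ (i, j) = cnj ((A + B) $$ (j, i))" if "i < n" "j < n" for i j
  proof -
    have "A $$ (i, j) = cnj (A $$ (j, i))" "B $$ (i, j) = cnj (B $$ (j, i))"
      using A(2) B(2) that unfolding selfadjoint_mat_iff[OF A(1)] selfadjoint_mat_iff[OF B(1)] by blast+
    then show ?thesis using A(1) B(1) that by simp
  qed
  then show ?thesis using A B by (subst selfadjoint_mat_iff[of _ n]) auto
qed

lemma selfadjoint_mat_smult:
  assumes A: "A \<in> carrier_mat n n" "selfadjoint_mat A"
  shows "selfadjoint_mat (complex_of_real l \<cdot>\<^sub>m A)"
proof -
  have "(complex_of_real l \<cdot>\<^sub>m A) $$ (i, j) = cnj ((complex_of_real l \<cdot>\<^sub>m A) $$ (j, i))"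
    if "i < n" "j < n" for i j
  proof -
    have "A $$ (i, j) = cnj (A $$ (j, i))"
      using A(2) that unfolding selfadjoint_mat_iff[OF A(1)] by blast
    then show ?thesis using A(1) that by simp
  qed
  then show ?thesis using A by (subst selfadjoint_mat_iff[of _ n]) auto
qed

lemma selfadjoint_mat_diff:
  assumes A: "A \<in> carrier_mat n n" "selfadjoint_mat A" and B: "B \<in> carrier_mat n n" "selfadjoint_mat B"
  shows "selfadjoint_mat (A - B)"
proof -
  have "A - B = A + complex_of_real (- 1) \<cdot>\<^sub>m B" using A(1) B(1) by (intro eq_matI) auto
  then show ?thesis
    using selfadjoint_mat_add[OF A _ selfadjoint_mat_smult[OF B, of "- 1"]] B(1) by simp
qed

lemma Im_quadratic_form_selfadjoint:
  assumes A: "A \<in> carrier_mat n n" "selfadjoint_mat A" and v: "v \<in> carrier_vec n"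
  shows "Im ((A *\<^sub>v v) \<bullet>c v) = 0"
proof -
  let ?s = "\<Sum>i<n. \<Sum>j<n. A $$ (i, j) * v $ j * cnj (v $ i)"
  have "cnj ?s = (\<Sum>i<n. \<Sum>j<n. A $$ (j, i) * v $ i * cnj (v $ j))"
    unfolding cnj_sum
  proof (intro sum.cong refl)
    fix i j assume "i \<in> {..<n}" "j \<in> {..<n}"
    then have "A $$ (j, i) = cnj (A $$ (i, j))"
      using A(2) unfolding selfadjoint_mat_iff[OF A(1)] by blast
    then show "cnj (A $$ (i, j) * v $ j * cnj (v $ i)) = A $$ (j, i) * v $ i * cnj (v $ j)"
      by simp
  qed
  also have "\<dots> = ?s" by (rule sum.swap)
  finally have "cnj ?s = ?s" .
  moreover have "cnj s = s \<Longrightarrow> Im s = 0" for s by (simp add: complex_eq_iff)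
  ultimately have "Im ?s = 0" by blast
  then show ?thesis unfolding quadratic_form_eq_sum[OF A(1) v] .
qed

lemma loewner_le_iff:
  assumes A: "A \<in> carrier_mat n n" "selfadjoint_mat A" and B: "B \<in> carrier_mat n n" "selfadjoint_mat B"
  shows "loewner_le n A B \<longleftrightarrow> (\<forall>v\<in>carrier_vec n. quad_form A v \<le> quad_form B v)"
proof -
  have c: "B - A \<in> carrier_mat n n" using A(1) by (rule minus_carrier_mat)
  note sa = selfadjoint_mat_diff[OF B A]
  have "0 \<le> ((B - A) *\<^sub>v v) \<bullet>c v \<longleftrightarrow> quad_form A v \<le> quad_form B v" if v: "v \<in> carrier_vec n" for v
    using Im_quadratic_form_selfadjoint[OF c sa v] quad_form_diff[OF B(1) A(1) v]
    by (simp add: less_eq_complex_def quad_form_def)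
  then show ?thesis unfolding loewner_le_def psd_mat_def using c sa by blast
qed

section \<open>Exact expansion of the functional calculus\<close>

text \<open>Nonnegativity of the quadratic form of a real kernel on \<open>{..<n}\<close>, tested on real vectors only.
  The kernel is not required to be symmetric.\<close>

definition pos_kernel :: "nat \<Rightarrow> (nat \<Rightarrow> nat \<Rightarrow> real) \<Rightarrow> bool" where
  "pos_kernel n K \<longleftrightarrow> (\<forall>x. 0 \<le> (\<Sum>i<n. \<Sum>j<n. K i j * x i * x j))"

lemma pos_kernel_complex:
  assumes "pos_kernel n K"
  shows "0 \<le> (\<Sum>i<n. \<Sum>j<n. K i j * Re (cnj (z i) * z j))"
proof -
  have "(\<Sum>i<n. \<Sum>j<n. K i j * Re (cnj (z i) * z j))
      = (\<Sum>i<n. \<Sum>j<n. K i j * Re (z i) * Re (z j)) + (\<Sum>i<n. \<Sum>j<n. K i j * Im (z i) * Im (z j))"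
    by (simp add: sum.distrib ring_distribs mult.assoc)
  moreover have "0 \<le> (\<Sum>i<n. \<Sum>j<n. K i j * Re (z i) * Re (z j))"
      "0 \<le> (\<Sum>i<n. \<Sum>j<n. K i j * Im (z i) * Im (z j))"
    using assms by (simp_all add: pos_kernel_def)
  ultimately show ?thesis by linarith
qed

text \<open>The error at \<open>t\<close> when \<open>h\<close> is replaced by the affine function of slope \<open>D i j\<close> through
  \<open>(c i, h (c i))\<close>. If \<open>D i j\<close> is the first divided difference of \<open>h\<close>, this function interpolates
  \<open>h\<close> at \<open>c i\<close> and \<open>c j\<close>, and the error is \<open>(t - c i) (t - c j)\<close> times the second divided
  difference of \<open>h\<close> at \<open>t\<close>, \<open>c i\<close>, \<open>c j\<close>. The slopes are a parameter so that coinciding or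
  boundary nodes can be treated with limits of divided differences.\<close>

definition interp_err :: "(real \<Rightarrow> real) \<Rightarrow> (nat \<Rightarrow> nat \<Rightarrow> real) \<Rightarrow> (nat \<Rightarrow> real) \<Rightarrow> real \<Rightarrow> nat \<Rightarrow> nat \<Rightarrow> real" where
  "interp_err h D c t i j = h t - h (c i) - (t - c i) * D i j"

text \<open>An exact Taylor formula for the functional calculus of \<open>A = diag_conj n W a\<close> around the
  diagonal matrix with entries \<open>c\<close>. In \<open>\<langle>h(A)x, x\<rangle>\<close> each value \<open>h (a k)\<close> is multiplied with a double
  sum over \<open>i\<close> and \<open>j\<close>; in its \<open>(i, j)\<close> term \<open>h\<close> is replaced by its affine approximation, whose
  contribution depends on \<open>A\<close> only through the entry \<open>A $$ (i, j)\<close>. The second sum is the value at the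
  diagonal matrix, the third one is affine in \<open>A\<close>, and the first one collects the errors. The slopes \<open>D\<close> are
  arbitrary.\<close>

lemma quad_form_expansion:
  assumes W: "unitary_mat n W" and x: "x \<in> carrier_vec n"
  shows "quad_form (diag_conj n W (\<lambda>k. h (a k))) x =
      (\<Sum>k<n. \<Sum>i<n. \<Sum>j<n. interp_err h D c (a k) i j *
          Re (cnj (cnj (W $$ (i, k)) * x $ i) * (cnj (W $$ (j, k)) * x $ j)))
    + (\<Sum>j<n. h (c j) * (cmod (x $ j))\<^sup>2)
    + (\<Sum>i<n. \<Sum>j<n. D i j * Re ((diag_conj n W a $$ (i, j) - (if i = j then of_real (c i) else 0))
          * (cnj (x $ i) * x $ j)))"
proof -
  note cW = unitary_matD(1)[OF W]
  define z where "z k i = cnj (W $$ (i, k)) * x $ i" for k i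
  have orth: "(\<Sum>k<n. W $$ (i, k) * cnj (W $$ (j, k))) = (if i = j then 1 else 0)"
    if ij: "i < n" "j < n" for i j
  proof -
    have "(\<Sum>k<n. W $$ (i, k) * cnj (W $$ (j, k))) = (W * mat_adjoint W) $$ (i, j)"
      using cW ij by (simp add: scalar_prod_def atLeast0LessThan)
    then show ?thesis unfolding unitary_matD(4)[OF W] using ij by simp
  qed
  have "quad_form (diag_conj n W (\<lambda>k. h (a k))) x = (\<Sum>k<n. h (a k) * (cmod (\<Sum>j<n. z k j))\<^sup>2)"
    unfolding quad_form_diag_conj[OF cW x] z_def
    using cW x by (intro sum.cong refl) (simp add: scalar_prod_def atLeast0LessThan)
  also have "\<dots> = (\<Sum>k<n. \<Sum>i<n. \<Sum>j<n. h (a k) * Re (cnj (z k i) * z k j))"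
  proof (rule sum.cong[OF refl])
    fix k
    have "(cmod (\<Sum>j<n. z k j))\<^sup>2 = Re ((\<Sum>j<n. z k j) * cnj (\<Sum>j<n. z k j))"
      by (simp only: complex_norm_square[symmetric] Re_complex_of_real)
    also have "\<dots> = Re (\<Sum>i<n. \<Sum>j<n. cnj (z k i) * z k j)"
      by (subst mult.commute) (simp only: cnj_sum sum_product)
    finally show "h (a k) * (cmod (\<Sum>j<n. z k j))\<^sup>2 = (\<Sum>i<n. \<Sum>j<n. h (a k) * Re (cnj (z k i) * z k j))"
      by (simp only: Re_sum sum_distrib_left)
  qed
  also have "\<dots> = (\<Sum>k<n. \<Sum>i<n. \<Sum>j<n. interp_err h D c (a k) i j * Re (cnj (z k i) * z k j))
      + (\<Sum>k<n. \<Sum>i<n. \<Sum>j<n. (h (c i) + (a k - c i) * D i j) * Re (cnj (z k i) * z k j))"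
    unfolding sum.distrib[symmetric] by (intro sum.cong refl) (simp add: interp_err_def algebra_simps)
  also have "(\<Sum>k<n. \<Sum>i<n. \<Sum>j<n. (h (c i) + (a k - c i) * D i j) * Re (cnj (z k i) * z k j))
      = (\<Sum>i<n. \<Sum>j<n. \<Sum>k<n. (h (c i) + (a k - c i) * D i j) * Re (cnj (z k i) * z k j))"
    by (rule sum_rotate3[symmetric])
  also have "\<dots> = (\<Sum>i<n. \<Sum>j<n. (if i = j then h (c i) * (cmod (x $ i))\<^sup>2 else 0) +
      D i j * Re ((diag_conj n W a $$ (i, j) - (if i = j then of_real (c i) else 0)) * (cnj (x $ i) * x $ j)))"
  proof (intro sum.cong refl)
    fix i j assume "i \<in> {..<n}" "j \<in> {..<n}"
    then have ij: "i < n" "j < n" by auto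
    have re: "Re (of_real r * w) = r * Re w" for r w by simp
    let ?x = "cnj (x $ i) * x $ j" and ?w = "\<lambda>k. W $$ (i, k) * cnj (W $$ (j, k))"
    have "(\<Sum>k<n. (h (c i) + (a k - c i) * D i j) * Re (cnj (z k i) * z k j))
        = (\<Sum>k<n. Re (of_real (h (c i)) * (?w k * ?x) + of_real (D i j) * ((of_real (a k) * ?w k - of_real (c i) * ?w k) * ?x)))"
      by (rule sum.cong[OF refl]) (simp add: z_def algebra_simps)
    also have "\<dots> = Re (of_real (h (c i)) * ((\<Sum>k<n. ?w k) * ?x)
          + of_real (D i j) * (((\<Sum>k<n. of_real (a k) * ?w k) - of_real (c i) * (\<Sum>k<n. ?w k)) * ?x))"
      by (simp only: Re_sum[symmetric] sum.distrib sum_subtractf sum_distrib_left[symmetric] sum_distrib_right[symmetric])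
    also have "(\<Sum>k<n. of_real (a k) * ?w k) = diag_conj n W a $$ (i, j)"
      unfolding diag_conj_index[OF cW ij] by (simp add: mult.assoc)
    finally have "(\<Sum>k<n. (h (c i) + (a k - c i) * D i j) * Re (cnj (z k i) * z k j))
        = h (c i) * Re ((if i = j then 1 else 0) * ?x)
          + D i j * Re ((diag_conj n W a $$ (i, j) - of_real (c i) * (if i = j then 1 else 0)) * ?x)"
      by (simp only: orth[OF ij] plus_complex.sel re)
    moreover have "Re ((if i = j then 1 else 0) * ?x) = (if i = j then (cmod (x $ i))\<^sup>2 else 0)"
      by (auto simp: cmod_def power2_eq_square)
    ultimately show "(\<Sum>k<n. (h (c i) + (a k - c i) * D i j) * Re (cnj (z k i) * z k j))
      = (if i = j then h (c i) * (cmod (x $ i))\<^sup>2 else 0) +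
        D i j * Re ((diag_conj n W a $$ (i, j) - (if i = j then of_real (c i) else 0)) * ?x)"
      by (simp only: mult_1_right mult_zero_right if_distrib[of "(*) _"] cong: if_cong)
  qed
  finally show ?thesis by (simp add: sum.distrib z_def)
qed

section \<open>Positive error kernels imply matrix convexity\<close>

lemma quad_form_change_basis:
  assumes U: "U \<in> carrier_mat n n" and V: "V \<in> carrier_mat n n" and x: "x \<in> carrier_vec n"
  shows "quad_form (diag_conj n U d) (V *\<^sub>v x) = quad_form (diag_conj n (mat_adjoint V * U) d) x"
proof -
  note cU = mat_adjoint_carrier[OF U] and cV = mat_adjoint_carrier[OF V]
  have "V *\<^sub>v x \<in> carrier_vec n" "mat_adjoint V * U \<in> carrier_mat n n" using assms cV by auto
  moreover have "mat_adjoint (mat_adjoint V * U) *\<^sub>v x = mat_adjoint U *\<^sub>v (V *\<^sub>v x)"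
    unfolding mat_adjoint_mult[OF cV U] mat_adjoint_adjoint by (rule assoc_mult_mat_vec[OF cU V x])
  ultimately show ?thesis using assms by (simp add: quad_form_diag_conj)
qed

lemma diag_conj_one_index:
  assumes "i < n" "j < n"
  shows "diag_conj n (1\<^sub>m n) c $$ (i, j) = (if i = j then complex_of_real (c i) else 0)"
proof -
  have "diag_conj n (1\<^sub>m n) c $$ (i, j) = (\<Sum>k<n. if k = i then (if i = j then complex_of_real (c i) else 0) else 0)"
    unfolding diag_conj_index[OF one_carrier_mat assms] using assms by (intro sum.cong refl) auto
  then show ?thesis using assms by simp
qed

lemma quad_form_diag_conj_one:
  assumes "x \<in> carrier_vec n"
  shows "quad_form (diag_conj n (1\<^sub>m n) c) x = (\<Sum>j<n. c j * (cmod (x $ j))\<^sup>2)"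
proof -
  have "mat_adjoint (1\<^sub>m n) = (1\<^sub>m n :: complex mat)" by (rule eq_matI) auto
  then show ?thesis using assms by (simp add: quad_form_diag_conj)
qed

lemma unitary_row_norm:
  assumes W: "unitary_mat n W" and j: "j < n"
  shows "(\<Sum>k<n. (cmod (W $$ (j, k)))\<^sup>2) = 1"
proof -
  have "complex_of_real (\<Sum>k<n. (cmod (W $$ (j, k)))\<^sup>2) = (\<Sum>k<n. W $$ (j, k) * cnj (W $$ (j, k)))"
    by (simp only: of_real_sum complex_norm_square)
  also have "\<dots> = (W * mat_adjoint W) $$ (j, j)"
    using unitary_matD(1)[OF W] j by (simp add: scalar_prod_def atLeast0LessThan)
  also have "\<dots> = 1" unfolding unitary_matD(4)[OF W] using j by simp
  finally show ?thesis using of_real_eq_1_iff by blast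
qed

lemma diag_conj_diagonal_mem:
  assumes W: "unitary_mat n W" and "convex I" and a: "\<And>k. k < n \<Longrightarrow> a k \<in> I" and j: "j < n"
  shows "Re (diag_conj n W a $$ (j, j)) \<in> I"
proof -
  have "Re (diag_conj n W a $$ (j, j)) = (\<Sum>k<n. (cmod (W $$ (j, k)))\<^sup>2 *\<^sub>R a k)"
    unfolding diag_conj_index[OF unitary_matD(1)[OF W] j j] Re_sum
    by (intro sum.cong refl) (simp add: cmod_power2, simp add: algebra_simps power2_eq_square)
  moreover have "\<dots> \<in> I"
    using unitary_row_norm[OF W j] a by (intro convex_sum[OF _ \<open>convex I\<close>]) auto
  ultimately show ?thesis by simp
qed

text \<open>In an eigenbasis of a convex combination \<open>C\<close> of \<open>A\<close> and \<open>B\<close>, the first-order terms of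
  the two expansions around \<open>C\<close> cancel and the error terms are nonnegative.\<close>

lemma n_convex_onI_kernel:
  assumes "convex I"
    and K: "\<And>c. (\<And>i. i < n \<Longrightarrow> c i \<in> I) \<Longrightarrow> \<exists>D. \<forall>a\<in>I. pos_kernel n (interp_err f D c a)"
  shows "n_convex_on n I f"
  unfolding n_convex_on_def
proof (intro ballI)
  fix A B :: "complex mat" and l :: real
  assume A: "A \<in> selfadjoint_mats_on n I" and B: "B \<in> selfadjoint_mats_on n I" and l: "l \<in> {0..1}"
  obtain U a where U: "unitary_mat n U" and AU: "A = diag_conj n U a" and a: "\<And>k. k < n \<Longrightarrow> a k \<in> I"
    by (rule selfadjoint_mats_onE[OF A]) (rule that; assumption)
  obtain U' b where U': "unitary_mat n U'" and BU': "B = diag_conj n U' b" and b: "\<And>k. k < n \<Longrightarrow> b k \<in> I"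
    by (rule selfadjoint_mats_onE[OF B]) (rule that; assumption)
  let ?comb = "\<lambda>X Y. complex_of_real l \<cdot>\<^sub>m X + complex_of_real (1 - l) \<cdot>\<^sub>m Y"
  have carrier_comb: "?comb X Y \<in> carrier_mat n n" and sa_comb: "selfadjoint_mat (?comb X Y)"
    if "X \<in> carrier_mat n n" "selfadjoint_mat X" "Y \<in> carrier_mat n n" "selfadjoint_mat Y" for X Y
    using that by (auto simp del: of_real_diff intro!: selfadjoint_mat_add selfadjoint_mat_smult)
  have cAB: "A \<in> carrier_mat n n" "B \<in> carrier_mat n n" and sAB: "selfadjoint_mat A" "selfadjoint_mat B"
    using A B by (auto simp: selfadjoint_mats_on_def)
  define C where "C = ?comb A B"
  obtain V c where V: "unitary_mat n V" and CV: "C = diag_conj n V c"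
    using spectral_theorem[of C n] carrier_comb[OF cAB(1) sAB(1) cAB(2) sAB(2)]
      sa_comb[OF cAB(1) sAB(1) cAB(2) sAB(2)] unfolding C_def diag_conj_def by blast
  note cU = unitary_matD[OF U] and cU' = unitary_matD[OF U'] and cV = unitary_matD[OF V]
  define W where "W = mat_adjoint V * U"
  define W' where "W' = mat_adjoint V * U'"
  have W: "unitary_mat n W" "unitary_mat n W'"
    unfolding W_def W'_def using U U' V by (auto intro: unitary_mat_mult unitary_mat_adjoint)
  note cW = unitary_matD(1)[OF W(1)] unitary_matD(1)[OF W(2)]
  have "diag_conj n (1\<^sub>m n) c = mat_adjoint V * C * V"
    unfolding CV diag_conj_compress[OF cV(1) cV(1)] cV ..
  also have "\<dots> = ?comb (mat_adjoint V * A * V) (mat_adjoint V * B * V)"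
    unfolding C_def using cV cAB
    by (simp add: mult_add_distrib_mat[of _ n n _ n] add_mult_distrib_mat[of _ n n _ _ n]
        mult_smult_distrib[of _ n n _ n] mult_smult_assoc_mat[of _ n n _ n])
  also have "\<dots> = ?comb (diag_conj n W a) (diag_conj n W' b)"
    unfolding AU BU' diag_conj_compress[OF cU(1) cV(1)] diag_conj_compress[OF cU'(1) cV(1)] W_def W'_def ..
  finally have comb: "of_real l * diag_conj n W a $$ (i, j) + of_real (1 - l) * diag_conj n W' b $$ (i, j)
      = (if i = j then complex_of_real (c i) else 0)" if "i < n" "j < n" for i j
    using diag_conj_one_index[OF that, of c] diag_conj_carrier[OF cW(1), of a]
      diag_conj_carrier[OF cW(2), of b] that by simp
  have c: "c j \<in> I" if "j < n" for j
  proof -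
    have "c j = l *\<^sub>R Re (diag_conj n W a $$ (j, j)) + (1 - l) *\<^sub>R Re (diag_conj n W' b $$ (j, j))"
      using arg_cong[OF comb[OF that that], of Re] by simp
    moreover have "\<dots> \<in> I"
      by (intro convexD[OF \<open>convex I\<close>] diag_conj_diagonal_mem W \<open>convex I\<close> a b that) (use l in auto)
    ultimately show ?thesis by simp
  qed
  obtain D where D: "\<And>t. t \<in> I \<Longrightarrow> pos_kernel n (interp_err f D c t)" using K[of c] c by blast
  have fA: "mat_fun f A = diag_conj n U (\<lambda>k. f (a k))" and fB: "mat_fun f B = diag_conj n U' (\<lambda>k. f (b k))"
    and fC: "mat_fun f C = diag_conj n V (\<lambda>k. f (c k))"
    unfolding AU BU' CV by (auto intro: mat_fun_diag_conj U U' V)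
  have cf: "mat_fun f A \<in> carrier_mat n n" "mat_fun f B \<in> carrier_mat n n" "mat_fun f C \<in> carrier_mat n n"
    and sf: "selfadjoint_mat (mat_fun f A)" "selfadjoint_mat (mat_fun f B)" "selfadjoint_mat (mat_fun f C)"
    unfolding fA fB fC using cU cU' cV by (auto intro: selfadjoint_diag_conj)
  have "loewner_le n (mat_fun f C) (?comb (mat_fun f A) (mat_fun f B))"
    unfolding loewner_le_iff[OF cf(3) sf(3) carrier_comb[OF cf(1) sf(1) cf(2) sf(2)] sa_comb[OF cf(1) sf(1) cf(2) sf(2)]]
  proof
    fix v :: "complex vec" assume v: "v \<in> carrier_vec n"
    define x where "x = mat_adjoint V *\<^sub>v v"
    have x: "x \<in> carrier_vec n" unfolding x_def using cV v by simp
    have "V *\<^sub>v x = (V * mat_adjoint V) *\<^sub>v v"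
      unfolding x_def by (rule assoc_mult_mat_vec[symmetric, OF cV(1,2) v])
    then have vx: "v = V *\<^sub>v x" unfolding cV using v by simp
    define S where "S = (\<Sum>j<n. f (c j) * (cmod (x $ j))\<^sup>2)"
    define T where "T M = (\<Sum>i<n. \<Sum>j<n. D i j * Re ((M $$ (i, j) - (if i = j then of_real (c i) else 0))
          * (cnj (x $ i) * x $ j)))" for M
    have qC: "quad_form (mat_fun f C) v = S"
      unfolding fC vx quad_form_change_basis[OF cV(1) cV(1) x] cV quad_form_diag_conj_one[OF x] S_def ..
    have err: "0 \<le> (\<Sum>k<n. \<Sum>i<n. \<Sum>j<n. interp_err f D c (d k) i j *
          Re (cnj (cnj (Z $$ (i, k)) * x $ i) * (cnj (Z $$ (j, k)) * x $ j)))"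
      if "\<And>k. k < n \<Longrightarrow> d k \<in> I" for d and Z :: "complex mat"
      using that by (intro sum_nonneg pos_kernel_complex D) auto
    have qA: "quad_form (mat_fun f A) v \<ge> S + T (diag_conj n W a)"
      unfolding fA vx quad_form_change_basis[OF cU(1) cV(1) x] W_def[symmetric]
        quad_form_expansion[OF W(1) x, of f a D c] S_def T_def using err[OF a, where Z = W] by simp
    have qB: "quad_form (mat_fun f B) v \<ge> S + T (diag_conj n W' b)"
      unfolding fB vx quad_form_change_basis[OF cU'(1) cV(1) x] W'_def[symmetric]
        quad_form_expansion[OF W(2) x, of f b D c] S_def T_def using err[OF b, where Z = W'] by simp
    \<comment> \<open>The first-order terms are linear in the matrix, so they cancel in the convex combination.\<close>
    have "l * T (diag_conj n W a) + (1 - l) * T (diag_conj n W' b) = (\<Sum>i<n. \<Sum>j<n. 0)"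
      unfolding T_def sum_distrib_left sum.distrib[symmetric]
    proof (intro sum.cong refl)
      fix i j assume "i \<in> {..<n}" "j \<in> {..<n}"
      then have ij: "i < n" "j < n" by auto
      let ?\<delta> = "if i = j then complex_of_real (c i) else 0" and ?x = "cnj (x $ i) * x $ j"
      have "l * Re ((p - d) * y) + (1 - l) * Re ((q - d) * y)
          = Re ((of_real l * p + of_real (1 - l) * q - d) * y)" for p q d y
        by (simp add: algebra_simps)
      then have "l * Re ((diag_conj n W a $$ (i, j) - ?\<delta>) * ?x) + (1 - l) * Re ((diag_conj n W' b $$ (i, j) - ?\<delta>) * ?x)
          = Re ((of_real l * diag_conj n W a $$ (i, j) + of_real (1 - l) * diag_conj n W' b $$ (i, j) - ?\<delta>) * ?x)" .
      also have "\<dots> = 0" unfolding comb[OF ij] by simp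
      finally have z: "l * Re ((diag_conj n W a $$ (i, j) - ?\<delta>) * ?x) + (1 - l) * Re ((diag_conj n W' b $$ (i, j) - ?\<delta>) * ?x) = 0" .
      have "l * (r * p) + (1 - l) * (r * q) = r * (l * p + (1 - l) * q)" for r p q :: real
        by (simp add: algebra_simps)
      then show "l * (D i j * Re ((diag_conj n W a $$ (i, j) - ?\<delta>) * ?x))
          + (1 - l) * (D i j * Re ((diag_conj n W' b $$ (i, j) - ?\<delta>) * ?x)) = 0"
        using z by (simp only: mult_zero_right)
    qed
    then have T0: "l * T (diag_conj n W a) + (1 - l) * T (diag_conj n W' b) = 0" by simp
    have "S = l * (S + T (diag_conj n W a)) + (1 - l) * (S + T (diag_conj n W' b))"
      using T0 by (simp add: algebra_simps)
    also have "\<dots> \<le> l * quad_form (mat_fun f A) v + (1 - l) * quad_form (mat_fun f B) v"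
      using l qA qB by (intro add_mono mult_left_mono) auto
    also have "\<dots> = quad_form (?comb (mat_fun f A) (mat_fun f B)) v"
      using cf v by (simp only: quad_form_add[of _ n] quad_form_smult[of _ n] smult_carrier_mat)
    finally show "quad_form (mat_fun f C) v \<le> quad_form (?comb (mat_fun f A) (mat_fun f B)) v"
      unfolding qC .
  qed
  then show "loewner_le n (mat_fun f (?comb A B)) (?comb (mat_fun f A) (mat_fun f B))"
    unfolding C_def .
qed

section \<open>Derivative of the functional calculus\<close>

lemma C2_on_openE:
  assumes "C2_on S h" "open S"
  obtains h' h'' where "\<And>x. x \<in> S \<Longrightarrow> (h has_real_derivative h' x) (at x)"
    "\<And>x. x \<in> S \<Longrightarrow> (h' has_real_derivative h'' x) (at x)" "continuous_on S h''"
    "\<And>x. x \<in> S \<Longrightarrow> deriv h x = h' x"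
proof -
  obtain h' h'' where h: "\<forall>x\<in>S. (h has_real_derivative h' x) (at x within S)"
    "\<forall>x\<in>S. (h' has_real_derivative h'' x) (at x within S)" "continuous_on S h''"
    using assms(1) unfolding C2_on_def by blast
  then have "(h has_real_derivative h' x) (at x)" "(h' has_real_derivative h'' x) (at x)" if "x \<in> S" for x
    using that at_within_open[OF that \<open>open S\<close>] by auto
  with h(3) that show ?thesis using DERIV_imp_deriv by metis
qed

text \<open>The Loewner matrix of \<open>h\<close> at the nodes \<open>c\<close>.\<close>

abbreviation (input) loewner_kernel :: "(real \<Rightarrow> real) \<Rightarrow> (nat \<Rightarrow> real) \<Rightarrow> nat \<Rightarrow> nat \<Rightarrow> real" where
  "loewner_kernel h c \<equiv> \<lambda>i j. divdiff2 h (c i) (c j)"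

text \<open>The second divided differences of a \<open>C\<^sup>2\<close> function are bounded on compact intervals. On the
  diagonal this is Taylor's estimate; off the diagonal the nodes are distinct and the Lipschitz bound
  for \<open>h\<close> suffices.\<close>

lemma interp_err_bound_pair:
  assumes h: "\<And>x. x \<in> {p..q} \<Longrightarrow> (h has_real_derivative h' x) (at x)"
    and h': "\<And>x. x \<in> {p..q} \<Longrightarrow> (h' has_real_derivative h'' x) (at x)"
    and h'': "continuous_on {p..q} h''"
    and c: "c i \<in> {p..q}" "c j \<in> {p..q}" "c i = c j \<Longrightarrow> i = j"
  shows "\<exists>K\<ge>0. \<forall>b\<in>{p..q}. \<bar>interp_err h (loewner_kernel h c) c b i j\<bar> \<le> K * (\<bar>b - c i\<bar> * \<bar>b - c j\<bar>)"
proof -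
  have bd: "\<exists>M\<ge>0. \<forall>x\<in>{p..q}. \<bar>g x\<bar> \<le> M" if "continuous_on {p..q} g" for g :: "real \<Rightarrow> real"
  proof -
    have "bounded (g ` {p..q})"
      by (intro compact_imp_bounded compact_continuous_image that compact_Icc)
    then obtain M where "\<forall>y\<in>g ` {p..q}. \<bar>y\<bar> \<le> M" unfolding bounded_real by blast
    then show ?thesis by (intro exI[of _ "\<bar>M\<bar>"]) force
  qed
  obtain M1 where M1: "M1 \<ge> 0" "\<And>x. x \<in> {p..q} \<Longrightarrow> \<bar>h' x\<bar> \<le> M1"
    using bd[of h'] h' by (meson DERIV_continuous_on has_field_derivative_at_within)
  obtain M2 where M2: "M2 \<ge> 0" "\<And>x. x \<in> {p..q} \<Longrightarrow> \<bar>h'' x\<bar> \<le> M2"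
    using bd[OF h''] by blast
  have lip: "\<bar>h x - h y\<bar> \<le> M1 * \<bar>x - y\<bar>" if "x \<in> {p..q}" "y \<in> {p..q}" for x y
    using field_differentiable_bound[of "{p..q}" h h' M1 x y] h M1 that
    by (auto intro: has_field_derivative_at_within)
  have lip': "\<bar>h' x - h' y\<bar> \<le> M2 * \<bar>x - y\<bar>" if "x \<in> {p..q}" "y \<in> {p..q}" for x y
    using field_differentiable_bound[of "{p..q}" h' h'' M2 x y] h' M2 that
    by (auto intro: has_field_derivative_at_within)
  show ?thesis
  proof (cases "i = j")
    case True
    have "\<bar>interp_err h (loewner_kernel h c) c b i j\<bar> \<le> M2 * (\<bar>b - c i\<bar> * \<bar>b - c j\<bar>)" if b: "b \<in> {p..q}" for b
    proof -
      let ?\<phi> = "\<lambda>t. h t - h (c i) - (t - c i) * h' (c i)"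
      have seg: "closed_segment (c i) b \<subseteq> {p..q}"
        using c(1) b by (intro closed_segment_subset) auto
      have "\<bar>?\<phi> b - ?\<phi> (c i)\<bar> \<le> (M2 * \<bar>b - c i\<bar>) * \<bar>b - c i\<bar>"
      proof (rule field_differentiable_bound[of "closed_segment (c i) b" ?\<phi> "\<lambda>t. h' t - h' (c i)", unfolded real_norm_def])
        fix t assume t: "t \<in> closed_segment (c i) b"
        have "(h has_real_derivative h' t) (at t within closed_segment (c i) b)"
          using h[of t] t seg by (blast intro: has_field_derivative_at_within)
        then show "(?\<phi> has_real_derivative h' t - h' (c i)) (at t within closed_segment (c i) b)"
          by (auto intro!: derivative_eq_intros)
        have "\<bar>t - c i\<bar> \<le> \<bar>b - c i\<bar>"
          using t by (auto simp: closed_segment_eq_real_ivl split: if_splits)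
        moreover have "\<bar>h' t - h' (c i)\<bar> \<le> M2 * \<bar>t - c i\<bar>" using lip' t seg c(1) by blast
        ultimately show "\<bar>h' t - h' (c i)\<bar> \<le> M2 * \<bar>b - c i\<bar>"
          using M2(1) by (meson mult_left_mono order_trans)
      qed auto
      moreover have "deriv h (c i) = h' (c i)" using h c(1) DERIV_imp_deriv by blast
      ultimately show ?thesis using True by (simp add: interp_err_def divdiff2_def mult.assoc)
    qed
    then show ?thesis using M2(1) by blast
  next
    case False
    define e where "e = c i - c j"
    have e: "e \<noteq> 0" using False c(3) by (auto simp: e_def)
    have "\<bar>interp_err h (loewner_kernel h c) c b i j\<bar> \<le> (2 * M1 / \<bar>e\<bar>) * (\<bar>b - c i\<bar> * \<bar>b - c j\<bar>)"
      if b: "b \<in> {p..q}" for b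
    proof -
      have "interp_err h (loewner_kernel h c) c b i j * e
          = (b - c j) * (h b - h (c i)) - (b - c i) * (h b - h (c j))"
        using e by (simp add: interp_err_def divdiff2_def e_def field_simps)
      then have "\<bar>interp_err h (loewner_kernel h c) c b i j\<bar> * \<bar>e\<bar>
          \<le> \<bar>b - c j\<bar> * \<bar>h b - h (c i)\<bar> + \<bar>b - c i\<bar> * \<bar>h b - h (c j)\<bar>"
        by (metis abs_mult abs_triangle_ineq4)
      also have "\<dots> \<le> \<bar>b - c j\<bar> * (M1 * \<bar>b - c i\<bar>) + \<bar>b - c i\<bar> * (M1 * \<bar>b - c j\<bar>)"
        using lip[OF b c(1)] lip[OF b c(2)] by (intro add_mono mult_left_mono) auto
      finally show ?thesis using e by (simp add: field_simps)
    qed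
    moreover have "0 \<le> 2 * M1 / \<bar>e\<bar>" using M1 by simp
    ultimately show ?thesis by blast
  qed
qed

lemma interp_err_bound:
  assumes C2: "C2_on {u<..<w} h" and c: "\<And>i. i < n \<Longrightarrow> c i \<in> {p..q}" and inj: "inj_on c {..<n}"
    and pq: "u < p" "q < w"
  obtains K where "K \<ge> 0" "\<And>b i j. b \<in> {p..q} \<Longrightarrow> i < n \<Longrightarrow> j < n \<Longrightarrow>
    \<bar>interp_err h (loewner_kernel h c) c b i j\<bar> \<le> K * (\<bar>b - c i\<bar> * \<bar>b - c j\<bar>)"
proof -
  have sub: "x \<in> {u<..<w}" if "x \<in> {p..q}" for x using that pq by auto
  obtain h' h'' where h: "\<And>x. x \<in> {u<..<w} \<Longrightarrow> (h has_real_derivative h' x) (at x)"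
    "\<And>x. x \<in> {u<..<w} \<Longrightarrow> (h' has_real_derivative h'' x) (at x)" "continuous_on {u<..<w} h''"
    by (rule C2_on_openE[OF C2]) auto
  have h'': "continuous_on {p..q} h''"
    by (rule continuous_on_subset[OF h(3)]) (rule subsetI, rule sub)
  have "\<exists>K\<ge>0. \<forall>b\<in>{p..q}. \<bar>interp_err h (loewner_kernel h c) c b i j\<bar> \<le> K * (\<bar>b - c i\<bar> * \<bar>b - c j\<bar>)"
    if "i < n" "j < n" for i j
    using that inj c
    by (intro interp_err_bound_pair[of p q h h' h'' c i j] h sub h'') (auto dest: inj_onD)
  then obtain K where K: "\<And>i j. i < n \<Longrightarrow> j < n \<Longrightarrow> 0 \<le> K i j"
    "\<And>i j b. i < n \<Longrightarrow> j < n \<Longrightarrow> b \<in> {p..q} \<Longrightarrow>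
      \<bar>interp_err h (loewner_kernel h c) c b i j\<bar> \<le> K i j * (\<bar>b - c i\<bar> * \<bar>b - c j\<bar>)"
    by metis
  define K0 where "K0 = (\<Sum>i<n. \<Sum>j<n. K i j)"
  have le: "K i j \<le> K0" if "i < n" "j < n" for i j
  proof -
    have "K i j \<le> (\<Sum>j<n. K i j)" using that K(1) by (intro member_le_sum) auto
    also have "\<dots> \<le> K0" unfolding K0_def
      using that K(1) by (intro member_le_sum[of i _ "\<lambda>i. \<Sum>j<n. K i j"]) (auto intro: sum_nonneg)
    finally show ?thesis .
  qed
  show ?thesis
  proof (rule that)
    show "0 \<le> K0" unfolding K0_def using K(1) by (intro sum_nonneg) auto
    fix b i j assume *: "b \<in> {p..q}" "i < n" "j < n"
    have "K i j * (\<bar>b - c i\<bar> * \<bar>b - c j\<bar>) \<le> K0 * (\<bar>b - c i\<bar> * \<bar>b - c j\<bar>)"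
      using le[OF *(2,3)] by (intro mult_right_mono) auto
    then show "\<bar>interp_err h (loewner_kernel h c) c b i j\<bar> \<le> K0 * (\<bar>b - c i\<bar> * \<bar>b - c j\<bar>)"
      using K(2)[OF *(2,3,1)] by linarith
  qed
qed

text \<open>Real matrices and vectors, regarded as complex ones.\<close>

definition real_mat :: "nat \<Rightarrow> (nat \<Rightarrow> nat \<Rightarrow> real) \<Rightarrow> complex mat" where
  "real_mat n X = Matrix.mat n n (\<lambda>(i, j). complex_of_real (X i j))"

definition real_vec :: "nat \<Rightarrow> (nat \<Rightarrow> real) \<Rightarrow> complex vec" where
  "real_vec n x = Matrix.vec n (\<lambda>i. complex_of_real (x i))"

text \<open>The matrix entries of \<open>diag(c) + l X\<close>.\<close>

abbreviation (input) diag_perturb :: "(nat \<Rightarrow> real) \<Rightarrow> (nat \<Rightarrow> nat \<Rightarrow> real) \<Rightarrow> real \<Rightarrow> nat \<Rightarrow> nat \<Rightarrow> real" where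
  "diag_perturb c X l \<equiv> \<lambda>i j. (if i = j then c i else 0) + l * X i j"

lemma real_mat_carrier [simp]: "real_mat n X \<in> carrier_mat n n"
  and real_mat_index [simp]: "i < n \<Longrightarrow> j < n \<Longrightarrow> real_mat n X $$ (i, j) = complex_of_real (X i j)"
  by (auto simp: real_mat_def)

lemma real_vec_carrier [simp]: "real_vec n x \<in> carrier_vec n"
  and real_vec_index [simp]: "i < n \<Longrightarrow> real_vec n x $ i = complex_of_real (x i)"
  by (auto simp: real_vec_def)

lemma real_mat_dim [simp]: "dim_row (real_mat n X) = n" "dim_col (real_mat n X) = n"
  and real_vec_dim [simp]: "dim_vec (real_vec n x) = n"
  by (auto simp: real_mat_def real_vec_def)

lemma selfadjoint_real_mat:
  assumes "\<And>i j. i < n \<Longrightarrow> j < n \<Longrightarrow> X i j = X j i"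
  shows "selfadjoint_mat (real_mat n X)"
proof -
  have "real_mat n X $$ (i, j) = cnj (real_mat n X $$ (j, i))" if "i < n" "j < n" for i j
    using assms[OF that] that by simp
  then show ?thesis unfolding selfadjoint_mat_iff[OF real_mat_carrier] by blast
qed

text \<open>The \<open>i\<close>-th coordinate of the eigenvector equation for \<open>diag(c) + l X\<close>: an eigenvector can
  have a large \<open>i\<close>-th entry only if its eigenvalue is close to \<open>c i\<close>.\<close>

lemma eigenvalue_localisation:
  assumes W: "unitary_mat n W"
    and B: "real_mat n (diag_perturb c X l) = diag_conj n W b"
    and i: "i < n" and k: "k < n"
  shows "\<bar>b k - c i\<bar> * cmod (W $$ (i, k)) \<le> \<bar>l\<bar> * (\<Sum>i<n. \<Sum>j<n. \<bar>X i j\<bar>)"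
proof -
  note cW = unitary_matD[OF W]
  let ?D = "mat_diag n (\<lambda>i. complex_of_real (b i))"
  have W1: "cmod (W $$ (j, k)) \<le> 1" if "j < n" for j
  proof -
    have "(cmod (W $$ (j, k)))\<^sup>2 \<le> (\<Sum>k<n. (cmod (W $$ (j, k)))\<^sup>2)"
      using k by (intro member_le_sum) auto
    then show ?thesis unfolding unitary_row_norm[OF W that] by (simp add: abs_square_le_1)
  qed
  have "real_mat n (diag_perturb c X l) * W = W * ?D"
    unfolding B diag_conj_def using cW mat_diag_dim[of n "\<lambda>i. complex_of_real (b i)"]
    by (simp add: assoc_mult_mat[of _ n n _ n _ n] mult_carrier_mat[of _ n n _ n]
        right_mult_one_mat[of _ n n])
  then have "(real_mat n (diag_perturb c X l) * W) $$ (i, k) = W $$ (i, k) * of_real (b k)"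
    unfolding mat_diag_mult_right[OF cW(1)] using i k by simp
  moreover have "(real_mat n (diag_perturb c X l) * W) $$ (i, k)
      = (\<Sum>j<n. of_real (diag_perturb c X l i j) * W $$ (j, k))"
    using cW i k
    by (simp add: scalar_prod_def atLeast0LessThan)
  moreover have "(\<Sum>j<n. of_real (diag_perturb c X l i j) * W $$ (j, k))
      = (\<Sum>j<n. if j = i then of_real (c i) * W $$ (i, k) else 0) + of_real l * (\<Sum>j<n. of_real (X i j) * W $$ (j, k))"
    unfolding sum_distrib_left sum.distrib[symmetric] by (intro sum.cong refl) (auto simp: algebra_simps)
  ultimately have "of_real (b k - c i) * W $$ (i, k) = of_real l * (\<Sum>j<n. of_real (X i j) * W $$ (j, k))"
    using i by (simp add: algebra_simps)
  then have "\<bar>b k - c i\<bar> * cmod (W $$ (i, k)) = \<bar>l\<bar> * cmod (\<Sum>j<n. of_real (X i j) * W $$ (j, k))"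
    by (metis norm_mult norm_of_real)
  also have "\<dots> \<le> \<bar>l\<bar> * (\<Sum>j<n. \<bar>X i j\<bar>)"
  proof (intro mult_left_mono sum_norm_le)
    fix j assume "j \<in> {..<n}"
    then show "cmod (of_real (X i j) * W $$ (j, k)) \<le> \<bar>X i j\<bar>"
      using mult_left_le[OF W1[of j], of "\<bar>X i j\<bar>"] by (simp add: norm_mult)
  qed simp
  also have "\<dots> \<le> \<bar>l\<bar> * (\<Sum>i<n. \<Sum>j<n. \<bar>X i j\<bar>)"
    using i by (intro mult_left_mono member_le_sum[of i _ "\<lambda>i. \<Sum>j<n. \<bar>X i j\<bar>"]) (auto intro: sum_nonneg)
  finally show ?thesis .
qed

text \<open>The derivative of the functional calculus at a diagonal matrix in the direction \<open>X\<close> is given by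
  the entrywise product with the Loewner matrix. Only quadratic forms on real vectors and one-sided
  perturbations are needed. In the error term of the expansion the bound
  \<open>K\<^sub>0 \<bar>b k - c i\<bar> \<bar>b k - c j\<bar>\<close> meets the entries of the eigenvectors, and eigenvalue localisation makes
  the product quadratic in \<open>l\<close>.\<close>

lemma quad_form_perturbation:
  assumes C2: "C2_on {u<..<w} h" and n: "0 < n"
    and c: "\<And>i. i < n \<Longrightarrow> c i \<in> {u<..<w}" and inj: "inj_on c {..<n}"
    and X: "\<And>i j. i < n \<Longrightarrow> j < n \<Longrightarrow> X i j = X j i"
  obtains K \<delta> where "\<delta> > 0"
    "\<And>l. 0 \<le> l \<Longrightarrow> l < \<delta> \<Longrightarrow> real_mat n (diag_perturb c X l) \<in> selfadjoint_mats_on n {u<..<w}"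
    "\<And>l. 0 \<le> l \<Longrightarrow> l < \<delta> \<Longrightarrow>
      \<bar>quad_form (mat_fun h (real_mat n (diag_perturb c X l))) (real_vec n x)
        - (\<Sum>j<n. h (c j) * (x j)\<^sup>2)
        - l * (\<Sum>i<n. \<Sum>j<n. loewner_kernel h c i j * X i j * x i * x j)\<bar> \<le> K * l\<^sup>2"
proof -
  let ?D = "loewner_kernel h c"
  define lo where "lo = Min (c ` {..<n})"
  define hi where "hi = Max (c ` {..<n})"
  have ne: "c ` {..<n} \<noteq> {}" using n by auto
  have lohi: "lo \<le> c i" "c i \<le> hi" if "i < n" for i
    unfolding lo_def hi_def using that by auto
  have "lo \<in> c ` {..<n}" "hi \<in> c ` {..<n}"
    unfolding lo_def hi_def using ne by (auto intro: Min_in Max_in simp del: image_is_empty)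
  then have lohi_in: "u < lo" "hi < w" using c by auto
  \<comment> \<open>The compact interval on which the error kernel is bounded; \<open>\<delta>\<close> keeps the eigenvalues in it.\<close>
  define p where "p = (u + lo) / 2"
  define q where "q = (w + hi) / 2"
  have pq: "u < p" "p < lo" "hi < q" "q < w" using lohi_in by (auto simp: p_def q_def)
  define \<eta> where "\<eta> = min (lo - p) (q - hi)"
  have \<eta>: "\<eta> > 0" using pq by (simp add: \<eta>_def)
  define s where "s = (\<Sum>i<n. \<Sum>j<n. \<bar>X i j\<bar>)"
  have s: "0 \<le> s" unfolding s_def by (intro sum_nonneg) auto
  define \<delta> where "\<delta> = \<eta> / (real n * (s + 1))"
  have \<delta>: "\<delta> > 0" using \<eta> n s by (simp add: \<delta>_def)
  have cpq: "c i \<in> {p..q}" if "i < n" for i using lohi[OF that] pq by auto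
  obtain K0 where K0: "K0 \<ge> 0" "\<And>b i j. b \<in> {p..q} \<Longrightarrow> i < n \<Longrightarrow> j < n \<Longrightarrow>
      \<bar>interp_err h ?D c b i j\<bar> \<le> K0 * (\<bar>b - c i\<bar> * \<bar>b - c j\<bar>)"
    by (rule interp_err_bound[OF C2 cpq inj pq(1,4)]) auto
  define K where "K = (\<Sum>k<n. \<Sum>i<n. \<Sum>j<n. K0 * (s * s) * (\<bar>x i\<bar> * \<bar>x j\<bar>))"
  have main: "real_mat n (diag_perturb c X l) \<in> selfadjoint_mats_on n {u<..<w} \<and>
      \<bar>quad_form (mat_fun h (real_mat n (diag_perturb c X l))) (real_vec n x)
        - (\<Sum>j<n. h (c j) * (x j)\<^sup>2)
        - l * (\<Sum>i<n. \<Sum>j<n. ?D i j * X i j * x i * x j)\<bar> \<le> K * l\<^sup>2"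
    if l: "0 \<le> l" "l < \<delta>" for l
  proof -
    let ?B = "real_mat n (diag_perturb c X l)"
    have "selfadjoint_mat ?B" by (rule selfadjoint_real_mat) (use X in auto)
    then obtain W b where W: "unitary_mat n W" and B: "?B = diag_conj n W b"
      using spectral_theorem[of ?B n] by (auto simp: diag_conj_def)
    have loc: "\<bar>b k - c i\<bar> * cmod (W $$ (i, k)) \<le> l * s" if "i < n" "k < n" for i k
      using eigenvalue_localisation[OF W B that] l by (simp add: s_def)
    \<comment> \<open>A unit eigenvector has an entry of modulus at least \<open>1/n\<close>, hence the eigenvalue is close
      to the corresponding diagonal entry.\<close>
    have b: "b k \<in> {p..q}" if k: "k < n" for k
    proof -
      have "\<exists>i<n. 1 / real n \<le> cmod (W $$ (i, k))"
      proof (rule ccontr)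
        assume "\<not> ?thesis"
        then have small: "cmod (W $$ (i, k)) < 1 / real n" if "i < n" for i using that by (meson not_le)
        have "1 = (\<Sum>i<n. (cmod (mat_adjoint W $$ (k, i)))\<^sup>2)"
          by (rule unitary_row_norm[OF unitary_mat_adjoint[OF W] k, symmetric])
        also have "\<dots> = (\<Sum>i<n. (cmod (W $$ (i, k)))\<^sup>2)"
          using unitary_matD(1)[OF W] k by (intro sum.cong refl) simp
        also have "\<dots> < (\<Sum>i<n. 1 / real n)"
        proof (rule sum_strict_mono)
          fix i assume "i \<in> {..<n}"
          then have i: "cmod (W $$ (i, k)) < 1 / real n" using small by auto
          moreover have "1 / real n \<le> 1" using n by simp
          ultimately have "cmod (W $$ (i, k)) * cmod (W $$ (i, k)) \<le> 1 * cmod (W $$ (i, k))"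
            by (intro mult_right_mono) auto
          then show "(cmod (W $$ (i, k)))\<^sup>2 < 1 / real n" using i by (simp add: power2_eq_square)
        qed (use n in auto)
        also have "\<dots> = 1" using n by simp
        finally show False by simp
      qed
      then obtain i where i: "i < n" "1 / real n \<le> cmod (W $$ (i, k))" by blast
      have "\<bar>b k - c i\<bar> * (1 / real n) \<le> \<bar>b k - c i\<bar> * cmod (W $$ (i, k))"
        using i by (intro mult_left_mono) auto
      also have "\<dots> \<le> l * s" using loc[OF i(1) k] .
      also have "\<dots> \<le> \<delta> * (s + 1)" using l s by (intro mult_mono) auto
      also have "\<dots> = \<eta> * (1 / real n)" using n s by (simp add: \<delta>_def)
      finally have "\<bar>b k - c i\<bar> \<le> \<eta>" using n by (simp add: divide_le_cancel)
      then show ?thesis using lohi[OF i(1)] by (auto simp: \<eta>_def)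
    qed
    then have "b ` {..<n} \<subseteq> {u<..<w}" using pq by fastforce
    then have mem: "?B \<in> selfadjoint_mats_on n {u<..<w}"
      unfolding B diag_conj_mem_selfadjoint_mats_on[OF W] .
    define E where "E k i j = interp_err h ?D c (b k) i j *
          Re (cnj (cnj (W $$ (i, k)) * real_vec n x $ i) * (cnj (W $$ (j, k)) * real_vec n x $ j))" for k i j
    have E: "\<bar>E k i j\<bar> \<le> (K0 * (s * s) * (\<bar>x i\<bar> * \<bar>x j\<bar>)) * l\<^sup>2" if kij: "k < n" "i < n" "j < n" for k i j
    proof -
      have "\<bar>E k i j\<bar> \<le> (K0 * (\<bar>b k - c i\<bar> * \<bar>b k - c j\<bar>))
          * (cmod (W $$ (i, k)) * \<bar>x i\<bar> * (cmod (W $$ (j, k)) * \<bar>x j\<bar>))"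
        unfolding E_def abs_mult
      proof (intro mult_mono K0(2)[OF b[OF kij(1)] kij(2,3)])
        show "\<bar>Re (cnj (cnj (W $$ (i, k)) * real_vec n x $ i) * (cnj (W $$ (j, k)) * real_vec n x $ j))\<bar>
            \<le> cmod (W $$ (i, k)) * \<bar>x i\<bar> * (cmod (W $$ (j, k)) * \<bar>x j\<bar>)"
          by (rule order_trans[OF abs_Re_le_cmod]) (use kij in \<open>simp add: norm_mult\<close>)
      qed (use K0(1) in auto)
      also have "\<dots> = (\<bar>b k - c i\<bar> * cmod (W $$ (i, k))) * (\<bar>b k - c j\<bar> * cmod (W $$ (j, k)))
          * (K0 * (\<bar>x i\<bar> * \<bar>x j\<bar>))" by (simp add: mult_ac)
      also have "\<dots> \<le> (l * s) * (l * s) * (K0 * (\<bar>x i\<bar> * \<bar>x j\<bar>))"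
        by (rule mult_right_mono[OF mult_mono[OF loc[OF kij(2,1)] loc[OF kij(3,1)]]]) (use K0(1) l s in auto)
      finally show ?thesis by (simp add: power2_eq_square mult_ac)
    qed
    have "quad_form (mat_fun h ?B) (real_vec n x) = (\<Sum>k<n. \<Sum>i<n. \<Sum>j<n. E k i j)
        + (\<Sum>j<n. h (c j) * (cmod (real_vec n x $ j))\<^sup>2)
        + (\<Sum>i<n. \<Sum>j<n. ?D i j * Re ((?B $$ (i, j) - (if i = j then of_real (c i) else 0))
            * (cnj (real_vec n x $ i) * real_vec n x $ j)))"
      unfolding B mat_fun_diag_conj[OF W] E_def
      by (rule quad_form_expansion[OF W real_vec_carrier])
    also have "(\<Sum>j<n. h (c j) * (cmod (real_vec n x $ j))\<^sup>2) = (\<Sum>j<n. h (c j) * (x j)\<^sup>2)"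
      by (intro sum.cong refl) simp
    also have "(\<Sum>i<n. \<Sum>j<n. ?D i j * Re ((?B $$ (i, j) - (if i = j then of_real (c i) else 0))
            * (cnj (real_vec n x $ i) * real_vec n x $ j)))
        = l * (\<Sum>i<n. \<Sum>j<n. ?D i j * X i j * x i * x j)"
      unfolding sum_distrib_left by (intro sum.cong refl) auto
    finally have "\<bar>quad_form (mat_fun h ?B) (real_vec n x) - (\<Sum>j<n. h (c j) * (x j)\<^sup>2)
        - l * (\<Sum>i<n. \<Sum>j<n. ?D i j * X i j * x i * x j)\<bar> = \<bar>\<Sum>k<n. \<Sum>i<n. \<Sum>j<n. E k i j\<bar>"
      by simp
    also have "\<dots> \<le> (\<Sum>k<n. \<Sum>i<n. \<Sum>j<n. \<bar>E k i j\<bar>)"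
      by (intro order_trans[OF sum_abs] sum_mono order_refl)
    also have "\<dots> \<le> (\<Sum>k<n. \<Sum>i<n. \<Sum>j<n. (K0 * (s * s) * (\<bar>x i\<bar> * \<bar>x j\<bar>)) * l\<^sup>2)"
      by (intro sum_mono E) auto
    also have "\<dots> = K * l\<^sup>2" unfolding K_def sum_distrib_right ..
    finally show ?thesis using mem by blast
  qed
  show ?thesis by (rule that[OF \<delta>]) (use main in blast)+
qed

lemma
  assumes "A \<in> carrier_mat n n" "selfadjoint_mat A"
  shows mat_fun_carrier: "mat_fun f A \<in> carrier_mat n n"
    and selfadjoint_mat_fun: "selfadjoint_mat (mat_fun f A)"
proof -
  obtain U d where U: "unitary_mat n U" and A: "A = diag_conj n U d"
    using spectral_theorem[OF assms] by (auto simp: diag_conj_def)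
  show "mat_fun f A \<in> carrier_mat n n" "selfadjoint_mat (mat_fun f A)"
    unfolding A mat_fun_diag_conj[OF U]
    by (rule diag_conj_carrier[OF unitary_matD(1)[OF U]], rule selfadjoint_diag_conj[OF unitary_matD(1)[OF U]])
qed

lemma nonneg_if_quadratic_perturbation:
  fixes s K :: real
  assumes "\<delta> > 0" "\<And>l. 0 < l \<Longrightarrow> l < \<delta> \<Longrightarrow> 0 \<le> s + K * l"
  shows "0 \<le> s"
proof (rule tendsto_lowerbound)
  show "((\<lambda>l. s + K * l) \<longlongrightarrow> s) (at_right 0)" by (auto intro!: tendsto_eq_intros)
  show "\<forall>\<^sub>F l in at_right 0. 0 \<le> s + K * l"
    using assms by (auto simp: eventually_at_right_field)
qed simp

section \<open>Necessary conditions for monotonicity and convexity\<close>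

text \<open>Loewner's necessary condition, from the perturbation of \<open>diag(c)\<close> by multiples of the
  all-ones matrix.\<close>

theorem n_monotone_on_pos_kernel:
  assumes mono: "n_monotone_on n {u<..<w} h" and C2: "C2_on {u<..<w} h"
    and c: "\<And>i. i < n \<Longrightarrow> c i \<in> {u<..<w}" and inj: "inj_on c {..<n}"
  shows "pos_kernel n (loewner_kernel h c)"
  unfolding pos_kernel_def
proof
  fix x :: "nat \<Rightarrow> real"
  let ?X = "\<lambda>(i::nat) (j::nat). 1::real"
  let ?S = "\<Sum>j<n. h (c j) * (x j)\<^sup>2" and ?s = "\<Sum>i<n. \<Sum>j<n. loewner_kernel h c i j * x i * x j"
  let ?B = "\<lambda>l. real_mat n (diag_perturb c ?X l)"
  show "0 \<le> ?s"
  proof (cases "n = 0")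
    case False
    obtain K \<delta> where \<delta>: "\<delta> > 0" and mem: "\<And>l. 0 \<le> l \<Longrightarrow> l < \<delta> \<Longrightarrow> ?B l \<in> selfadjoint_mats_on n {u<..<w}"
      and est: "\<And>l. 0 \<le> l \<Longrightarrow> l < \<delta> \<Longrightarrow> \<bar>quad_form (mat_fun h (?B l)) (real_vec n x) - ?S
        - l * (\<Sum>i<n. \<Sum>j<n. loewner_kernel h c i j * ?X i j * x i * x j)\<bar> \<le> K * l\<^sup>2"
      by (rule quad_form_perturbation[OF C2 _ c inj, where X = ?X and x = x]) (use False in auto)
    have "0 \<le> ?s + K * l" if l: "0 < l" "l < \<delta>" for l
    proof -
      have sa: "selfadjoint_mat (?B r)" for r by (rule selfadjoint_real_mat) auto
      have "loewner_le n (?B 0) (?B l)"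
        unfolding loewner_le_iff[OF real_mat_carrier sa real_mat_carrier sa]
      proof
        fix v :: "complex vec" assume v: "v \<in> carrier_vec n"
        have "quad_form (?B l) v - quad_form (?B 0) v
            = l * (\<Sum>i<n. \<Sum>j<n. 1 * Re (cnj (v $ i) * v $ j))"
          unfolding quad_form_eq_sum[OF real_mat_carrier v] sum_subtractf[symmetric] sum_distrib_left
          by (intro sum.cong refl) (auto simp: algebra_simps)
        moreover have ones: "pos_kernel n (\<lambda>i j. 1)"
          by (simp add: pos_kernel_def flip: sum_product)
        moreover have "0 \<le> l * (\<Sum>i<n. \<Sum>j<n. 1 * Re (cnj (v $ i) * v $ j))"
          by (rule mult_nonneg_nonneg[OF less_imp_le[OF l(1)] pos_kernel_complex[OF ones]])
        ultimately show "quad_form (?B 0) v \<le> quad_form (?B l) v" by linarith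
      qed
      then have le: "loewner_le n (mat_fun h (?B 0)) (mat_fun h (?B l))"
        using mono mem[of 0] mem[of l] l \<delta> unfolding n_monotone_on_def by auto
      have "quad_form (mat_fun h (?B 0)) (real_vec n x) \<le> quad_form (mat_fun h (?B l)) (real_vec n x)"
        using le loewner_le_iff[OF mat_fun_carrier selfadjoint_mat_fun mat_fun_carrier selfadjoint_mat_fun,
          OF real_mat_carrier sa real_mat_carrier sa real_mat_carrier sa real_mat_carrier sa] real_vec_carrier by blast
      moreover have "quad_form (mat_fun h (?B 0)) (real_vec n x) = ?S" using est[of 0] \<delta> by simp
      ultimately have "0 \<le> l * (?s + K * l)"
        using est[of l] l by (simp add: power2_eq_square algebra_simps)
      then show ?thesis using l by (simp add: zero_le_mult_iff)
    qed
    then show ?thesis by (rule nonneg_if_quadratic_perturbation[OF \<delta>])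
  qed simp
qed

text \<open>The graph of a convex function lies above its tangent: \<open>h(A) \<ge> h(C) + Dh(C)(A - C)\<close> for
  \<open>C = diag(c)\<close> and a real matrix \<open>A\<close> with eigenvalues \<open>a\<close>. By the exact expansion of \<open>h(A)\<close>, the
  difference of the two sides is the error term.\<close>

lemma n_convex_on_gradient_inequality:
  assumes conv: "n_convex_on n {p<..<q} h" and C2: "C2_on {p<..<q} h"
    and c: "\<And>i. i < n \<Longrightarrow> c i \<in> {p<..<q}" and inj: "inj_on c {..<n}" and n: "0 < n"
    and U: "unitary_mat n (real_mat n u)" and a: "\<And>k. k < n \<Longrightarrow> a k \<in> {p<..<q}"
  shows "0 \<le> (\<Sum>k<n. \<Sum>i<n. \<Sum>j<n. interp_err h (loewner_kernel h c) c (a k) i j * ((u i k * x i) * (u j k * x j)))"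
proof -
  let ?D = "loewner_kernel h c" and ?U = "real_mat n u"
  define A where "A = diag_conj n ?U a"
  define X where "X i j = (\<Sum>k<n. a k * u i k * u j k) - (if i = j then c i else 0)" for i j
  let ?B = "\<lambda>l. real_mat n (diag_perturb c X l)"
  let ?S = "\<Sum>j<n. h (c j) * (x j)\<^sup>2" and ?s = "\<Sum>i<n. \<Sum>j<n. ?D i j * X i j * x i * x j"
  have A_index: "A $$ (i, j) = complex_of_real (\<Sum>k<n. a k * u i k * u j k)" if "i < n" "j < n" for i j
    unfolding A_def diag_conj_index[OF real_mat_carrier that] of_real_sum
    by (intro sum.cong refl) (use that in simp)
  have A: "A \<in> selfadjoint_mats_on n {p<..<q}"
    unfolding A_def diag_conj_mem_selfadjoint_mats_on[OF U] using a by auto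
  have cA: "A \<in> carrier_mat n n" "selfadjoint_mat A" using A by (auto simp: selfadjoint_mats_on_def)
  have sym: "X i j = X j i" for i j unfolding X_def by (simp add: mult_ac)
  obtain K \<delta> where \<delta>: "\<delta> > 0" and mem: "\<And>l. 0 \<le> l \<Longrightarrow> l < \<delta> \<Longrightarrow> ?B l \<in> selfadjoint_mats_on n {p<..<q}"
    and est: "\<And>l. 0 \<le> l \<Longrightarrow> l < \<delta> \<Longrightarrow> \<bar>quad_form (mat_fun h (?B l)) (real_vec n x) - ?S - l * ?s\<bar> \<le> K * l\<^sup>2"
    by (rule quad_form_perturbation[where X = X and x = x, OF C2 n c inj sym]) auto
  have sa: "selfadjoint_mat (?B l)" for l by (rule selfadjoint_real_mat) (use sym in auto)
  note f_carrier = mat_fun_carrier[OF real_mat_carrier sa] mat_fun_carrier[OF cA]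
    and f_sa = selfadjoint_mat_fun[OF real_mat_carrier sa] selfadjoint_mat_fun[OF cA]
  let ?q = "\<lambda>M. quad_form (mat_fun h M) (real_vec n x)"
  have pert: "0 \<le> (?q A - ?S - ?s) + K * l" if l: "0 < l" "l < min \<delta> 1" for l
  proof -
    have "?B l = complex_of_real l \<cdot>\<^sub>m A + complex_of_real (1 - l) \<cdot>\<^sub>m ?B 0"
    proof (rule eq_matI)
      fix i j assume "i < dim_row (complex_of_real l \<cdot>\<^sub>m A + complex_of_real (1 - l) \<cdot>\<^sub>m ?B 0)"
        "j < dim_col (complex_of_real l \<cdot>\<^sub>m A + complex_of_real (1 - l) \<cdot>\<^sub>m ?B 0)"
      then have ij: "i < n" "j < n" by auto
      have "diag_perturb c X l i j = l * (\<Sum>k<n. a k * u i k * u j k) + (1 - l) * (if i = j then c i else 0)"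
        by (simp add: X_def algebra_simps)
      then show "?B l $$ (i, j) = (complex_of_real l \<cdot>\<^sub>m A + complex_of_real (1 - l) \<cdot>\<^sub>m ?B 0) $$ (i, j)"
        using ij cA(1) by (simp add: A_index)
    qed (use cA in auto)
    moreover have "loewner_le n (mat_fun h (complex_of_real l \<cdot>\<^sub>m A + complex_of_real (1 - l) \<cdot>\<^sub>m ?B 0))
        (complex_of_real l \<cdot>\<^sub>m mat_fun h A + complex_of_real (1 - l) \<cdot>\<^sub>m mat_fun h (?B 0))"
      by (rule conv[unfolded n_convex_on_def, rule_format, OF A mem[OF order_refl \<delta>]]) (use l in auto)
    ultimately have "loewner_le n (mat_fun h (?B l))
        (complex_of_real l \<cdot>\<^sub>m mat_fun h A + complex_of_real (1 - l) \<cdot>\<^sub>m mat_fun h (?B 0))" by (simp only:)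
    moreover have "complex_of_real l \<cdot>\<^sub>m mat_fun h A + complex_of_real (1 - l) \<cdot>\<^sub>m mat_fun h (?B 0) \<in> carrier_mat n n"
      "selfadjoint_mat (complex_of_real l \<cdot>\<^sub>m mat_fun h A + complex_of_real (1 - l) \<cdot>\<^sub>m mat_fun h (?B 0))"
      by (intro add_carrier_mat smult_carrier_mat f_carrier)
        (intro selfadjoint_mat_add[of _ n] selfadjoint_mat_smult[of _ n] smult_carrier_mat f_carrier f_sa)
    ultimately have "?q (?B l) \<le> quad_form (complex_of_real l \<cdot>\<^sub>m mat_fun h A + complex_of_real (1 - l) \<cdot>\<^sub>m mat_fun h (?B 0)) (real_vec n x)"
      using loewner_le_iff[OF f_carrier(1) f_sa(1)] real_vec_carrier by blast
    also have "\<dots> = l * ?q A + (1 - l) * ?q (?B 0)"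
      using f_carrier by (simp only: quad_form_add[of _ n] quad_form_smult[of _ n] smult_carrier_mat real_vec_carrier)
    also have "?q (?B 0) = ?S" using est[of 0] \<delta> by simp
    finally have "?S + l * ?s - K * l\<^sup>2 \<le> l * ?q A + (1 - l) * ?S"
      using est[of l] l unfolding abs_le_iff by linarith
    then have "0 \<le> l * ((?q A - ?S - ?s) + K * l)"
      by (simp add: power2_eq_square algebra_simps)
    then show ?thesis using l by (simp add: zero_le_mult_iff)
  qed
  have "0 < min \<delta> 1" using \<delta> by simp
  then have ge: "0 \<le> ?q A - ?S - ?s"
    by (rule nonneg_if_quadratic_perturbation) (rule pert)
  have "?q A = (\<Sum>k<n. \<Sum>i<n. \<Sum>j<n. interp_err h ?D c (a k) i j *
          Re (cnj (cnj (?U $$ (i, k)) * real_vec n x $ i) * (cnj (?U $$ (j, k)) * real_vec n x $ j)))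
    + (\<Sum>j<n. h (c j) * (cmod (real_vec n x $ j))\<^sup>2)
    + (\<Sum>i<n. \<Sum>j<n. ?D i j * Re ((A $$ (i, j) - (if i = j then of_real (c i) else 0))
          * (cnj (real_vec n x $ i) * real_vec n x $ j)))"
    unfolding A_def mat_fun_diag_conj[OF U] by (rule quad_form_expansion[OF U real_vec_carrier])
  also have "(\<Sum>k<n. \<Sum>i<n. \<Sum>j<n. interp_err h ?D c (a k) i j *
          Re (cnj (cnj (?U $$ (i, k)) * real_vec n x $ i) * (cnj (?U $$ (j, k)) * real_vec n x $ j)))
      = (\<Sum>k<n. \<Sum>i<n. \<Sum>j<n. interp_err h ?D c (a k) i j * ((u i k * x i) * (u j k * x j)))"
    by (intro sum.cong refl) simp
  also have "(\<Sum>j<n. h (c j) * (cmod (real_vec n x $ j))\<^sup>2) = ?S" by (intro sum.cong refl) simp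
  also have "(\<Sum>i<n. \<Sum>j<n. ?D i j * Re ((A $$ (i, j) - (if i = j then of_real (c i) else 0))
          * (cnj (real_vec n x $ i) * real_vec n x $ j))) = ?s"
    by (intro sum.cong refl) (simp add: A_index X_def)
  finally show ?thesis using ge by simp
qed

lemma householder_unitary:
  fixes w :: "nat \<Rightarrow> real"
  assumes s: "s = (\<Sum>i<n. (w i)\<^sup>2)" "s \<noteq> 0"
  shows "unitary_mat n (real_mat n (\<lambda>i j. (if i = j then 1 else 0) - 2 * w i * w j / s))"
    (is "unitary_mat n (real_mat n ?u)")
proof (rule unitary_matI[OF real_mat_carrier])
  show "mat_adjoint (real_mat n ?u) * real_mat n ?u = 1\<^sub>m n"
  proof (rule eq_matI)
    fix i j assume "i < dim_row (1\<^sub>m n :: complex mat)" "j < dim_col (1\<^sub>m n :: complex mat)"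
    then have ij: "i < n" "j < n" by auto
    have "(mat_adjoint (real_mat n ?u) * real_mat n ?u) $$ (i, j)
        = (\<Sum>k<n. complex_of_real (?u k i * ?u k j))"
      using ij by (simp add: scalar_prod_def atLeast0LessThan del: of_real_diff)
    also have "\<dots> = complex_of_real (\<Sum>k<n. ?u k i * ?u k j)" by (rule of_real_sum[symmetric])
    also have "(\<Sum>k<n. ?u k i * ?u k j) = (\<Sum>k<n. (if k = i then if i = j then 1 else 0 else 0)
        - (if k = i then 2 * w i * w j / s else 0) - (if k = j then 2 * w i * w j / s else 0)
        + (4 * w i * w j / s\<^sup>2) * (w k)\<^sup>2)"
      by (intro sum.cong refl) (auto simp: power2_eq_square algebra_simps)
    also have "\<dots> = (if i = j then 1 else 0) - 2 * w i * w j / s - 2 * w i * w j / s + (4 * w i * w j / s\<^sup>2) * s"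
      unfolding sum.distrib sum_subtractf sum_distrib_left[symmetric] s(1)[symmetric] using ij by simp
    also have "\<dots> = (if i = j then 1 else 0)" using s(2) by (simp add: power2_eq_square)
    finally show "(mat_adjoint (real_mat n ?u) * real_mat n ?u) $$ (i, j) = 1\<^sub>m n $$ (i, j)"
      using ij by simp
  qed auto
qed

text \<open>A sharpening of Kraus's necessary condition: \<open>a\<close> is an arbitrary point of the interval, although
  only \<open>n \<times> n\<close> matrices are available. In the gradient inequality, \<open>A\<close> gets the eigenvalues
  \<open>a, c 1, \<dots>, c (n - 1)\<close> and as eigenvectors the columns of a Householder reflection that, up to the
  sign of the first column, is \<open>O(\<epsilon>)\<close>-close to the identity. The vector \<open>x\<close>, whose entries are of
  size \<open>O(1/\<epsilon>)\<close>, is chosen such that the error term of the eigenvalue \<open>a\<close> is the given quadratic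
  form. The error at \<open>c k\<close> vanishes in row and column \<open>k\<close>, which removes the large entries of the error terms of the other eigenvalues;
  what remains of them is \<open>O(\<epsilon>\<^sup>2)\<close>.\<close>

theorem n_convex_on_pos_kernel:
  assumes conv: "n_convex_on n {p<..<q} h" and C2: "C2_on {p<..<q} h"
    and c: "\<And>i. i < n \<Longrightarrow> c i \<in> {p<..<q}" and inj: "inj_on c {..<n}" and n: "0 < n"
    and a: "a \<in> {p<..<q}"
  shows "pos_kernel n (interp_err h (loewner_kernel h c) c a)"
  unfolding pos_kernel_def
proof
  fix m :: "nat \<Rightarrow> real"
  let ?D = "loewner_kernel h c"
  define Q where "Q = (\<Sum>i<n. \<Sum>j<n. interp_err h ?D c a i j * m i * m j)"
  define e where "e k i j = interp_err h ?D c (c k) i j" for k i j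
  have e0: "e k i j = 0" if "i = k \<or> j = k" for k i j
    using that by (auto simp: e_def interp_err_def divdiff2_def field_simps)
  define K where "K = (\<Sum>k\<in>{..<n} - {0}. \<Sum>i<n. \<Sum>j<n. \<bar>e k i j\<bar> * (16 * \<bar>m i\<bar> * \<bar>m j\<bar>))"
  have K: "0 \<le> K" unfolding K_def by (intro sum_nonneg) auto
  have pert: "0 \<le> Q + K * \<epsilon>" if \<epsilon>: "0 < \<epsilon>" "\<epsilon> < 1 / (2 * real n)" for \<epsilon>
  proof -
    have \<epsilon>n: "real n * \<epsilon> < 1 / 2" using \<epsilon>(2) n by (simp add: field_simps)
    have "\<epsilon> \<le> real n * \<epsilon>" using n \<epsilon>(1) by simp
    then have \<epsilon>1: "\<epsilon> < 1 / 2" using \<epsilon>n by linarith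
    define w where "w i = (if i = 0 then 1 else \<epsilon>)" for i :: nat
    define s where "s = (\<Sum>i<n. (w i)\<^sup>2)"
    have s: "1 \<le> s" "s \<le> 5 / 4"
    proof -
      have s_eq: "s = (w 0)\<^sup>2 + (\<Sum>i\<in>{..<n} - {0}. (w i)\<^sup>2)"
        unfolding s_def using n by (intro sum.remove) auto
      have "(\<Sum>i\<in>{..<n} - {0}. (w i)\<^sup>2) \<le> (\<Sum>i<n. \<epsilon>\<^sup>2)"
        by (rule order_trans[OF sum_mono sum_mono2]) (auto simp: w_def)
      also have "\<dots> = (real n * \<epsilon>) * \<epsilon>" by (simp add: power2_eq_square)
      also have "\<dots> \<le> (1 / 2) * (1 / 2)" using \<epsilon> \<epsilon>n \<epsilon>1 by (intro mult_mono) auto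
      finally show "s \<le> 5 / 4" unfolding s_eq by (simp add: w_def)
      show "1 \<le> s" unfolding s_eq by (simp add: w_def sum_nonneg)
    qed
    define u where "u i j = (if i = j then 1 else 0) - 2 * w i * w j / s" for i j
    have U: "unitary_mat n (real_mat n u)"
      unfolding u_def using s by (intro householder_unitary[OF s_def]) auto
    have u0: "u i 0 \<noteq> 0" for i
      using s \<epsilon>(1) by (auto simp: u_def w_def field_simps)
    \<comment> \<open>The reflection along \<open>w\<close> is symmetric with \<open>u 0 0\<close> near \<open>-1\<close> and \<open>u i 0\<close> of size \<open>\<epsilon>\<close> for
      \<open>i \<noteq> 0\<close>; since these entries do not vanish, the products \<open>u i 0 * x i\<close> can be prescribed.\<close>
    define x where "x i = m i / u i 0" for i
    have z0: "u i 0 * x i = m i" for i using u0[of i] by (simp add: x_def)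
    have z: "\<bar>u i k * x i\<bar> \<le> 4 * \<epsilon> * \<bar>m i\<bar>" if ki: "k \<noteq> 0" "i \<noteq> k" for i k
    proof (cases "i = 0")
      case True
      have "u i k * x i = 2 * \<epsilon> / (2 - s) * m i"
        using True ki s by (simp add: u_def x_def w_def field_simps)
      moreover have "2 * \<epsilon> / (2 - s) \<le> 4 * \<epsilon>"
      proof -
        have "2 * \<epsilon> / (2 - s) \<le> 2 * \<epsilon> / (1 / 2)" using s \<epsilon>(1) by (intro divide_left_mono) auto
        then show ?thesis by simp
      qed
      moreover have "0 \<le> 2 * \<epsilon> / (2 - s)" using s \<epsilon>(1) by simp
      ultimately show ?thesis
        using mult_right_mono[of "2 * \<epsilon> / (2 - s)" "4 * \<epsilon>" "\<bar>m i\<bar>"] by (simp only: abs_mult abs_of_nonneg abs_ge_zero)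
    next
      case False
      have "u i k * x i = \<epsilon> * m i"
        using False ki s \<epsilon>(1) by (simp add: u_def x_def w_def field_simps)
      then have "\<bar>u i k * x i\<bar> = \<epsilon> * \<bar>m i\<bar>" using \<epsilon>(1) by (simp add: abs_mult)
      also have "\<dots> \<le> 4 * \<epsilon> * \<bar>m i\<bar>" using \<epsilon>(1) by (intro mult_right_mono) auto
      finally show ?thesis .
    qed
    define a' where "a' k = (if k = 0 then a else c k)" for k
    define F where "F k = (\<Sum>i<n. \<Sum>j<n. interp_err h ?D c (a' k) i j * ((u i k * x i) * (u j k * x j)))" for k
    have "0 \<le> (\<Sum>k<n. F k)"
      unfolding F_def by (rule n_convex_on_gradient_inequality[OF conv C2 c inj n U]) (use a c in \<open>auto simp: a'_def\<close>)
    also have "\<dots> = F 0 + (\<Sum>k\<in>{..<n} - {0}. F k)" using n by (intro sum.remove) auto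
    also have "F 0 = Q" unfolding F_def Q_def z0 by (simp add: a'_def mult.assoc)
    also have "(\<Sum>k\<in>{..<n} - {0}. F k) \<le> (\<Sum>k\<in>{..<n} - {0}. \<Sum>i<n. \<Sum>j<n. (\<bar>e k i j\<bar> * (16 * \<bar>m i\<bar> * \<bar>m j\<bar>)) * \<epsilon>\<^sup>2)"
      unfolding F_def
    proof (intro sum_mono)
      fix k i j assume "k \<in> {..<n} - {0}"
      then have k: "k \<noteq> 0" by auto
      show "interp_err h ?D c (a' k) i j * ((u i k * x i) * (u j k * x j))
          \<le> (\<bar>e k i j\<bar> * (16 * \<bar>m i\<bar> * \<bar>m j\<bar>)) * \<epsilon>\<^sup>2"
      proof (cases "i = k \<or> j = k")
        case True
        then show ?thesis using e0[OF True] k by (simp add: a'_def e_def)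
      next
        case False
        have "interp_err h ?D c (a' k) i j * ((u i k * x i) * (u j k * x j))
            \<le> \<bar>e k i j * ((u i k * x i) * (u j k * x j))\<bar>" using k by (simp add: a'_def e_def)
        also have "\<dots> = \<bar>e k i j\<bar> * (\<bar>u i k * x i\<bar> * \<bar>u j k * x j\<bar>)" by (simp only: abs_mult)
        also have "\<dots> \<le> \<bar>e k i j\<bar> * ((4 * \<epsilon> * \<bar>m i\<bar>) * (4 * \<epsilon> * \<bar>m j\<bar>))"
          using z[OF k, of i] z[OF k, of j] False \<epsilon>(1) by (intro mult_left_mono mult_mono) auto
        also have "\<dots> = (\<bar>e k i j\<bar> * (16 * \<bar>m i\<bar> * \<bar>m j\<bar>)) * \<epsilon>\<^sup>2" by (simp add: power2_eq_square)
        finally show ?thesis .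
      qed
    qed
    also have "\<dots> = K * \<epsilon>\<^sup>2" unfolding K_def sum_distrib_right ..
    also have "K * \<epsilon>\<^sup>2 \<le> K * \<epsilon>"
      using K \<epsilon>(1) \<epsilon>1 by (intro mult_left_mono) (auto simp: power2_eq_square mult_left_le)
    finally show ?thesis by simp
  qed
  have "0 < 1 / (2 * real n)" using n by simp
  then show "0 \<le> (\<Sum>i<n. \<Sum>j<n. interp_err h ?D c a i j * m i * m j)"
    unfolding Q_def[symmetric] by (rule nonneg_if_quadratic_perturbation) (rule pert)
qed

section \<open>Multiplication by the identity function\<close>

lemma C2_on_subset:
  assumes "C2_on S f" "T \<subseteq> S"
  shows "C2_on T f"
  using assms unfolding C2_on_def
  by (meson has_field_derivative_subset continuous_on_subset subsetD)

lemma C2_on_divide_id: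
  assumes f: "C2_on {0<..<\<alpha>} f" and fg: "\<forall>t\<in>{0<..<\<alpha>}. f t = t * g t"
  shows "C2_on {0<..<\<alpha>} g"
proof -
  let ?S = "{0<..<\<alpha>}"
  obtain f' f'' where f': "\<And>x. x \<in> ?S \<Longrightarrow> (f has_real_derivative f' x) (at x)"
    and f'': "\<And>x. x \<in> ?S \<Longrightarrow> (f' has_real_derivative f'' x) (at x)" and cont: "continuous_on ?S f''"
    by (rule C2_on_openE[OF f]) auto
  define g' where "g' x = f' x / x - f x / x\<^sup>2" for x
  define g'' where "g'' x = f'' x / x - 2 * f' x / x\<^sup>2 + 2 * f x / x ^ 3" for x
  have "(g has_real_derivative g' x) (at x)" if x: "x \<in> ?S" for x
  proof (rule has_field_derivative_transform_within_open[where S = ?S and f = "\<lambda>t. f t / t"])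
    show "((\<lambda>t. f t / t) has_real_derivative g' x) (at x)"
      using f'[OF x] x by (auto intro!: derivative_eq_intros simp: g'_def power2_eq_square field_simps)
    show "f t / t = g t" if "t \<in> ?S" for t using bspec[OF fg that] that by simp
  qed (use x in auto)
  moreover have "(g' has_real_derivative g'' x) (at x)" if x: "x \<in> ?S" for x
    unfolding g'_def[abs_def] using f'[OF x] f''[OF x] x
    by (auto intro!: derivative_eq_intros simp: g''_def power2_eq_square power3_eq_cube field_simps)
  moreover have "continuous_on ?S g''"
  proof -
    have "continuous_on ?S f" "continuous_on ?S f'"
      using f' f'' by (meson DERIV_continuous_on has_field_derivative_at_within)+
    then show ?thesis unfolding g''_def[abs_def] using cont by (intro continuous_intros) auto
  qed
  ultimately show ?thesis unfolding C2_on_def by (meson has_field_derivative_at_within)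
qed

lemma deriv_times_id:
  assumes g: "C2_on {0<..<\<alpha>} g" and fg: "\<forall>t\<in>{0<..<\<alpha>}. f t = t * g t" and x: "x \<in> {0<..<\<alpha>}"
  shows "deriv f x = g x + x * deriv g x"
    and "deriv (deriv f) x = 2 * deriv g x + x * deriv (deriv g) x"
proof -
  let ?S = "{0<..<\<alpha>}"
  obtain g' g'' where g': "\<And>x. x \<in> ?S \<Longrightarrow> (g has_real_derivative g' x) (at x)"
    and g'': "\<And>x. x \<in> ?S \<Longrightarrow> (g' has_real_derivative g'' x) (at x)"
    and dg: "\<And>x. x \<in> ?S \<Longrightarrow> deriv g x = g' x"
    by (rule C2_on_openE[OF g]) auto
  have df: "deriv f y = g y + y * g' y" if y: "y \<in> ?S" for y
  proof (rule DERIV_imp_deriv, rule has_field_derivative_transform_within_open[where S = ?S and f = "\<lambda>t. t * g t"])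
    show "((\<lambda>t. t * g t) has_real_derivative g y + y * g' y) (at y)"
      using g'[OF y] by (auto intro!: derivative_eq_intros)
  qed (use y fg in auto)
  show "deriv f x = g x + x * deriv g x" using df[OF x] dg[OF x] by simp
  have "deriv (deriv f) x = 2 * g' x + x * g'' x"
  proof (rule DERIV_imp_deriv, rule has_field_derivative_transform_within_open[where S = ?S and f = "\<lambda>t. g t + t * g' t"])
    show "((\<lambda>t. g t + t * g' t) has_real_derivative 2 * g' x + x * g'' x) (at x)"
      using g'[OF x] g''[OF x] by (auto intro!: derivative_eq_intros)
  qed (use x df in auto)
  moreover have "deriv (deriv g) x = g'' x"
    by (rule DERIV_imp_deriv, rule has_field_derivative_transform_within_open[OF g''[OF x], where S = ?S])
      (use x dg in auto)
  ultimately show "deriv (deriv f) x = 2 * deriv g x + x * deriv (deriv g) x" using dg[OF x] by simp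
qed

lemma divdiff2_sym: "divdiff2 h s t = divdiff2 h t s"
  by (auto simp: divdiff2_def) (metis minus_diff_eq minus_divide_divide)

lemma divdiff2_times_id:
  assumes g: "C2_on {0<..<\<alpha>} g" and fg: "\<forall>t\<in>{0<..<\<alpha>}. f t = t * g t"
    and st: "s \<in> {0<..<\<alpha>}" "t \<in> {0<..<\<alpha>}"
  shows "divdiff2 f s t = s * divdiff2 g s t + g t"
proof (cases "s = t")
  case True
  then show ?thesis using deriv_times_id(1)[OF g fg st(1)] by (simp add: divdiff2_def)
next
  case False
  then show ?thesis using bspec[OF fg st(1)] bspec[OF fg st(2)] by (simp add: divdiff2_def field_simps)
qed

lemma divdiff3_times_id:
  assumes g: "C2_on {0<..<\<alpha>} g" and fg: "\<forall>t\<in>{0<..<\<alpha>}. f t = t * g t"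
    and stu: "s \<in> {0<..<\<alpha>}" "t \<in> {0<..<\<alpha>}" "u \<in> {0<..<\<alpha>}"
  shows "divdiff3 f s t u = s * divdiff3 g s t u + divdiff2 g t u"
proof -
  note l = divdiff2_times_id[OF g fg]
  consider "s \<noteq> u" | "s = u" "s = t" | "s = u" "s \<noteq> t" by blast
  then show ?thesis
  proof cases
    case 1
    have "divdiff2 f t u = u * divdiff2 g t u + g t"
      using l[OF stu(3,2)] by (simp only: divdiff2_sym[of _ t u])
    then show ?thesis using 1 l[OF stu(1,2)] by (simp add: divdiff3_def field_simps)
  next
    case 2
    then show ?thesis
      using deriv_times_id(2)[OF g fg stu(1)] by (simp add: divdiff3_def divdiff2_def)
  next
    case 3
    have "divdiff3 f s t u = (s * divdiff2 g s s + g s - (s * divdiff2 g s t + g t)) / (s - t)"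
      using 3 l[OF stu(1,1)] l[OF stu(1,2)] by (simp add: divdiff3_def)
    also have "\<dots> = s * divdiff3 g s t u + (g s - g t) / (s - t)"
      using 3 by (simp add: divdiff3_def add_divide_distrib diff_divide_distrib right_diff_distrib)
    also have "(g s - g t) / (s - t) = divdiff2 g s t" using 3 by (simp add: divdiff2_def)
    finally show ?thesis using 3 divdiff2_sym[of g s t] by simp
  qed
qed

text \<open>This is the Leibniz rule for second divided differences, multiplied by \<open>(a - c i) (a - c j)\<close>.
  In this form it also holds when nodes coincide.\<close>

lemma interp_err_times_id:
  assumes g: "C2_on {0<..<\<alpha>} g" and fg: "\<forall>t\<in>{0<..<\<alpha>}. f t = t * g t"
    and ac: "a \<in> {0<..<\<alpha>}" "c i \<in> {0<..<\<alpha>}" "c j \<in> {0<..<\<alpha>}"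
  shows "interp_err f (loewner_kernel f c) c a i j
    = a * interp_err g (loewner_kernel g c) c a i j + (a - c i) * (a - c j) * loewner_kernel g c i j"
proof -
  have "divdiff2 f (c i) (c j) = c j * divdiff2 g (c i) (c j) + g (c i)"
    using divdiff2_times_id[OF g fg ac(3,2)] by (simp only: divdiff2_sym[of _ "c i" "c j"])
  then show ?thesis unfolding interp_err_def bspec[OF fg ac(1)] bspec[OF fg ac(2)] by (simp add: algebra_simps)
qed

lemma pos_kernel_times_id:
  assumes g: "C2_on {0<..<\<alpha>} g" and fg: "\<forall>t\<in>{0<..<\<alpha>}. f t = t * g t"
    and a: "a \<in> {0<..<\<alpha>}" and c: "\<And>i. i < n \<Longrightarrow> c i \<in> {0<..<\<alpha>}"
    and pos: "pos_kernel n (loewner_kernel g c)" "pos_kernel n (interp_err g (loewner_kernel g c) c a)"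
  shows "pos_kernel n (interp_err f (loewner_kernel f c) c a)"
  unfolding pos_kernel_def
proof
  fix x :: "nat \<Rightarrow> real"
  have "(\<Sum>i<n. \<Sum>j<n. interp_err f (loewner_kernel f c) c a i j * x i * x j)
      = (\<Sum>i<n. \<Sum>j<n. a * (interp_err g (loewner_kernel g c) c a i j * x i * x j)
          + loewner_kernel g c i j * ((a - c i) * x i) * ((a - c j) * x j))"
    using c by (intro sum.cong refl)
      (simp add: interp_err_times_id[OF g fg a] algebra_simps)
  also have "\<dots> = a * (\<Sum>i<n. \<Sum>j<n. interp_err g (loewner_kernel g c) c a i j * x i * x j)
      + (\<Sum>i<n. \<Sum>j<n. loewner_kernel g c i j * ((a - c i) * x i) * ((a - c j) * x j))"
    by (simp only: sum.distrib sum_distrib_left)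
  finally show "0 \<le> (\<Sum>i<n. \<Sum>j<n. interp_err f (loewner_kernel f c) c a i j * x i * x j)"
    using pos[unfolded pos_kernel_def] a by simp
qed

section \<open>Passage to coinciding and boundary nodes\<close>

lemma filterlim_line_within:
  fixes z \<alpha> k :: real
  assumes z: "z \<in> {0..<\<alpha>}" and k: "k > 0"
  shows "filterlim (\<lambda>\<epsilon>. z + k * \<epsilon>) (at z within {0..<\<alpha>}) (at_right 0)"
    and "\<forall>\<^sub>F \<epsilon> in at_right 0. z + k * \<epsilon> \<in> {0<..<\<alpha>}"
proof -
  have lim: "((\<lambda>\<epsilon>. z + k * \<epsilon>) \<longlongrightarrow> z) (at_right 0)" by (auto intro!: tendsto_eq_intros)
  have "\<forall>\<^sub>F \<epsilon> in at_right 0. z + k * \<epsilon> < \<alpha>" by (rule order_tendstoD(2)[OF lim]) (use z in auto)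
  moreover have pos: "\<forall>\<^sub>F \<epsilon> in at_right (0::real). 0 < \<epsilon>" by (simp add: eventually_at_right_less)
  ultimately show in_open: "\<forall>\<^sub>F \<epsilon> in at_right 0. z + k * \<epsilon> \<in> {0<..<\<alpha>}"
    by eventually_elim (use z k in \<open>auto intro: add_nonneg_pos\<close>)
  have "\<forall>\<^sub>F \<epsilon> in at_right 0. z + k * \<epsilon> \<in> {0..<\<alpha>} \<and> z + k * \<epsilon> \<noteq> z"
    using in_open pos by eventually_elim (use k in auto)
  then show "filterlim (\<lambda>\<epsilon>. z + k * \<epsilon>) (at z within {0..<\<alpha>}) (at_right 0)"
    unfolding filterlim_at using lim by simp
qed

text \<open>Nodes in \<open>{0..<\<alpha>}\<close> are approached from the right along lines. Two nodes with the same limit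
  move with different speeds \<open>k\<close> and \<open>l\<close>, so the derivative of \<open>f\<close> at the limit, possibly one-sided,
  determines the limit of the divided difference. The case \<open>k = l\<close> is that of a single node and rests
  on the continuity of the derivative.\<close>

lemma tendsto_divdiff2_approach:
  assumes f': "\<And>x. x \<in> {0..<\<alpha>} \<Longrightarrow> (f has_real_derivative f' x) (at x within {0..<\<alpha>})"
    and cont: "continuous_on {0..<\<alpha>} f'"
    and st: "s \<in> {0..<\<alpha>}" "t \<in> {0..<\<alpha>}" and kl: "k > 0" "l > 0" "k = l \<Longrightarrow> s = t"
  shows "((\<lambda>\<epsilon>. divdiff2 f (s + k * \<epsilon>) (t + l * \<epsilon>))
    \<longlongrightarrow> (if s = t then f' s else (f s - f t) / (s - t))) (at_right 0)"
proof -
  have limf: "((\<lambda>\<epsilon>. f (z + m * \<epsilon>)) \<longlongrightarrow> f z) (at_right 0)" if "z \<in> {0..<\<alpha>}" "m > 0" for z m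
  proof -
    have "(f \<longlongrightarrow> f z) (at z within {0..<\<alpha>})"
      using DERIV_continuous[OF f'[OF that(1)]] by (simp add: continuous_within)
    then show ?thesis by (rule filterlim_compose[OF _ filterlim_line_within(1)[OF that]])
  qed
  consider "s \<noteq> t" | "s = t" "k = l" | "s = t" "k \<noteq> l" by blast
  then show ?thesis
  proof cases
    case 1
    have "((\<lambda>\<epsilon>. (s + k * \<epsilon>) - (t + l * \<epsilon>)) \<longlongrightarrow> s - t) (at_right 0)" by (auto intro!: tendsto_eq_intros)
    then have "\<forall>\<^sub>F \<epsilon> in at_right 0. (s + k * \<epsilon>) - (t + l * \<epsilon>) \<noteq> 0"
      by (rule tendsto_imp_eventually_ne) (use 1 in simp)
    then have ev: "\<forall>\<^sub>F \<epsilon> in at_right 0. (f (s + k * \<epsilon>) - f (t + l * \<epsilon>)) / ((s + k * \<epsilon>) - (t + l * \<epsilon>))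
        = divdiff2 f (s + k * \<epsilon>) (t + l * \<epsilon>)"
      by eventually_elim (auto simp: divdiff2_def)
    have "((\<lambda>\<epsilon>. (f (s + k * \<epsilon>) - f (t + l * \<epsilon>)) / ((s + k * \<epsilon>) - (t + l * \<epsilon>)))
        \<longlongrightarrow> (f s - f t) / (s - t)) (at_right 0)"
      using 1 st kl(1,2) by (auto intro!: tendsto_eq_intros limf)
    then show ?thesis using 1 Lim_transform_eventually[OF _ ev] by simp
  next
    case 2
    have "(f' \<longlongrightarrow> f' s) (at s within {0..<\<alpha>})" using cont st(1) by (simp add: continuous_on_def)
    then have "((\<lambda>\<epsilon>. f' (s + k * \<epsilon>)) \<longlongrightarrow> f' s) (at_right 0)"
      by (rule filterlim_compose[OF _ filterlim_line_within(1)[OF st(1) kl(1)]])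
    moreover have "\<forall>\<^sub>F \<epsilon> in at_right 0. f' (s + k * \<epsilon>) = divdiff2 f (s + k * \<epsilon>) (t + l * \<epsilon>)"
      using filterlim_line_within(2)[OF st(1) kl(1)]
    proof eventually_elim
      case (elim \<epsilon>)
      have "at (s + k * \<epsilon>) within {0..<\<alpha>} = at (s + k * \<epsilon>)"
        by (rule at_within_open_subset[OF elim]) auto
      then have "deriv f (s + k * \<epsilon>) = f' (s + k * \<epsilon>)"
        using f'[of "s + k * \<epsilon>"] elim by (intro DERIV_imp_deriv) auto
      then show ?case using 2 by (simp add: divdiff2_def)
    qed
    ultimately show ?thesis using 2 Lim_transform_eventually by force
  next
    case 3
    have quot: "((\<lambda>\<epsilon>. (f (s + m * \<epsilon>) - f s) / (m * \<epsilon>)) \<longlongrightarrow> f' s) (at_right 0)" if "m > 0" for m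
    proof -
      have "((\<lambda>y. (f y - f s) / (y - s)) \<longlongrightarrow> f' s) (at s within {0..<\<alpha>})"
        using f'[OF st(1)] by (simp add: has_field_derivative_iff)
      from filterlim_compose[OF this filterlim_line_within(1)[OF st(1) that]] show ?thesis by simp
    qed
    have "((\<lambda>\<epsilon>. (k * ((f (s + k * \<epsilon>) - f s) / (k * \<epsilon>)) - l * ((f (s + l * \<epsilon>) - f s) / (l * \<epsilon>))) / (k - l))
        \<longlongrightarrow> (k * f' s - l * f' s) / (k - l)) (at_right 0)"
      using 3 kl(1,2) by (intro tendsto_intros quot) auto
    moreover have "(k * f' s - l * f' s) / (k - l) = f' s" using 3 by (simp add: left_diff_distrib[symmetric])
    moreover have "\<forall>\<^sub>F \<epsilon> in at_right (0::real). 0 < \<epsilon>" by (simp add: eventually_at_right_less)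
    then have "\<forall>\<^sub>F \<epsilon> in at_right 0.
        (k * ((f (s + k * \<epsilon>) - f s) / (k * \<epsilon>)) - l * ((f (s + l * \<epsilon>) - f s) / (l * \<epsilon>))) / (k - l)
        = divdiff2 f (s + k * \<epsilon>) (t + l * \<epsilon>)"
    proof eventually_elim
      case (elim \<epsilon>)
      have "k * ((f (s + k * \<epsilon>) - f s) / (k * \<epsilon>)) - l * ((f (s + l * \<epsilon>) - f s) / (l * \<epsilon>))
          = (f (s + k * \<epsilon>) - f (s + l * \<epsilon>)) / \<epsilon>"
        using kl(1,2) elim by (simp add: field_simps)
      moreover have "s + k * \<epsilon> - (s + l * \<epsilon>) = (k - l) * \<epsilon>" by (simp add: algebra_simps)
      ultimately show ?case using 3 elim by (simp add: divdiff2_def mult.commute)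
    qed
    ultimately show ?thesis using 3 Lim_transform_eventually by force
  qed
qed

text \<open>Positivity of the error kernels extends from distinct interior nodes to arbitrary nodes, which may
  coincide or be \<open>0\<close>, with the limits of the divided differences as slopes.\<close>

lemma pos_kernel_endpoint:
  assumes f: "C2_on {0..<\<alpha>} f"
    and pos: "\<And>c a. (\<And>i. i < n \<Longrightarrow> c i \<in> {0<..<\<alpha>}) \<Longrightarrow> inj_on c {..<n} \<Longrightarrow> a \<in> {0<..<\<alpha>} \<Longrightarrow>
      pos_kernel n (interp_err f (loewner_kernel f c) c a)"
    and c: "\<And>i. i < n \<Longrightarrow> c i \<in> {0..<\<alpha>}"
  shows "\<exists>D. \<forall>a\<in>{0..<\<alpha>}. pos_kernel n (interp_err f D c a)"
proof -
  obtain f' f'' where f': "\<And>x. x \<in> {0..<\<alpha>} \<Longrightarrow> (f has_real_derivative f' x) (at x within {0..<\<alpha>})"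
    and f'': "\<And>x. x \<in> {0..<\<alpha>} \<Longrightarrow> (f' has_real_derivative f'' x) (at x within {0..<\<alpha>})"
    using f unfolding C2_on_def by blast
  have cont: "continuous_on {0..<\<alpha>} f'" using f'' by (rule DERIV_continuous_on)
  have contf: "continuous_on {0..<\<alpha>} f" using f' by (rule DERIV_continuous_on)
  define D where "D i j = (if c i = c j then f' (c i) else (f (c i) - f (c j)) / (c i - c j))" for i j
  have "pos_kernel n (interp_err f D c a)" if a: "a \<in> {0..<\<alpha>}" for a
    unfolding pos_kernel_def
  proof
    fix x :: "nat \<Rightarrow> real"
    let ?c = "\<lambda>\<epsilon> i. c i + real (Suc i) * \<epsilon>" and ?a = "\<lambda>\<epsilon>. a + 1 * \<epsilon>"
    have limf: "((\<lambda>\<epsilon>. f (z + m * \<epsilon>)) \<longlongrightarrow> f z) (at_right 0)" if "z \<in> {0..<\<alpha>}" "m > 0" for z m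
      using contf that(1) unfolding continuous_on_def
      by (intro filterlim_compose[OF _ filterlim_line_within(1)[OF that]]) blast
    have err: "((\<lambda>\<epsilon>. interp_err f (loewner_kernel f (?c \<epsilon>)) (?c \<epsilon>) (?a \<epsilon>) i j) \<longlongrightarrow> interp_err f D c a i j) (at_right 0)"
      if "i < n" "j < n" for i j
    proof -
      have "((\<lambda>\<epsilon>. divdiff2 f (?c \<epsilon> i) (?c \<epsilon> j)) \<longlongrightarrow> D i j) (at_right 0)"
        unfolding D_def by (rule tendsto_divdiff2_approach[OF f' cont c[OF that(1)] c[OF that(2)]]) auto
      moreover have "((\<lambda>\<epsilon>. ?a \<epsilon>) \<longlongrightarrow> a) (at_right 0)" "((\<lambda>\<epsilon>. ?c \<epsilon> i) \<longlongrightarrow> c i) (at_right 0)"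
        by (auto intro!: tendsto_eq_intros)
      moreover have "((\<lambda>\<epsilon>. f (?a \<epsilon>)) \<longlongrightarrow> f a) (at_right 0)" by (rule limf[OF a]) simp
      moreover have "((\<lambda>\<epsilon>. f (?c \<epsilon> i)) \<longlongrightarrow> f (c i)) (at_right 0)" by (rule limf[OF c[OF that(1)]]) simp
      ultimately show ?thesis unfolding interp_err_def by (intro tendsto_diff tendsto_mult)
    qed
    show "0 \<le> (\<Sum>i<n. \<Sum>j<n. interp_err f D c a i j * x i * x j)"
    proof (rule tendsto_lowerbound)
      show "((\<lambda>\<epsilon>. \<Sum>i<n. \<Sum>j<n. interp_err f (loewner_kernel f (?c \<epsilon>)) (?c \<epsilon>) (?a \<epsilon>) i j * x i * x j)
          \<longlongrightarrow> (\<Sum>i<n. \<Sum>j<n. interp_err f D c a i j * x i * x j)) (at_right 0)"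
        by (intro tendsto_sum tendsto_mult err tendsto_const) auto
      have "\<forall>\<^sub>F \<epsilon> in at_right 0. \<forall>i\<in>{..<n}. ?c \<epsilon> i \<in> {0<..<\<alpha>}"
        by (intro eventually_ball_finite ballI filterlim_line_within(2) c) auto
      moreover have "\<forall>\<^sub>F \<epsilon> in at_right 0. \<forall>i\<in>{..<n}. \<forall>j\<in>{..<n}. i \<noteq> j \<longrightarrow> ?c \<epsilon> i \<noteq> ?c \<epsilon> j"
      proof (intro eventually_ball_finite ballI finite_lessThan)
        fix i j
        show "\<forall>\<^sub>F \<epsilon> in at_right 0. i \<noteq> j \<longrightarrow> ?c \<epsilon> i \<noteq> ?c \<epsilon> j"
        proof (cases "c i = c j")
          case True
          have "\<forall>\<^sub>F \<epsilon> in at_right (0::real). 0 < \<epsilon>" by (simp add: eventually_at_right_less)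
          then show ?thesis by eventually_elim (use True in auto)
        next
          case False
          have "((\<lambda>\<epsilon>. ?c \<epsilon> i - ?c \<epsilon> j) \<longlongrightarrow> c i - c j) (at_right 0)" by (auto intro!: tendsto_eq_intros)
          then have "\<forall>\<^sub>F \<epsilon> in at_right 0. ?c \<epsilon> i - ?c \<epsilon> j \<noteq> 0"
            by (rule tendsto_imp_eventually_ne) (use False in simp)
          then show ?thesis by eventually_elim auto
        qed
      qed
      moreover have "\<forall>\<^sub>F \<epsilon> in at_right 0. ?a \<epsilon> \<in> {0<..<\<alpha>}" by (rule filterlim_line_within(2)[OF a]) simp
      ultimately show "\<forall>\<^sub>F \<epsilon> in at_right 0.
          0 \<le> (\<Sum>i<n. \<Sum>j<n. interp_err f (loewner_kernel f (?c \<epsilon>)) (?c \<epsilon>) (?a \<epsilon>) i j * x i * x j)"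
      proof eventually_elim
        case (elim \<epsilon>)
        have "pos_kernel n (interp_err f (loewner_kernel f (?c \<epsilon>)) (?c \<epsilon>) (?a \<epsilon>))"
          using elim by (intro pos) (auto simp only: inj_on_def lessThan_iff)
        then show ?case unfolding pos_kernel_def by blast
      qed
    qed simp
  qed
  then show ?thesis by blast
qed

section \<open>Convexity of the product\<close>

theorem proposition5p4:
  fixes \<alpha> :: real and n :: nat and f g :: "real \<Rightarrow> real"
  assumes "\<alpha> > 0" and "n \<ge> 1"
    and "C2_on {0..<\<alpha>} f"
    and "\<And>t. t \<in> {0<..<\<alpha>} \<Longrightarrow> f t = t * g t"
  shows "C2_on {0<..<\<alpha>} g \<and>
    (\<forall>t :: nat \<Rightarrow> real. inj_on t {1..n} \<longrightarrow> t ` {1..n} \<subseteq> {0<..<\<alpha>} \<longrightarrow>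
       (\<forall>i\<in>{1..n}. \<forall>j\<in>{1..n}.
          divdiff3 f (t 1) (t i) (t j) = t 1 * divdiff3 g (t 1) (t i) (t j) + divdiff2 g (t i) (t j))) \<and>
    (n_monotone_on n {0<..<\<alpha>} g \<longrightarrow> n_convex_on n {0<..<\<alpha>} g \<longrightarrow> n_convex_on n {0..<\<alpha>} f)"
proof -
  have fg: "\<forall>t\<in>{0<..<\<alpha>}. f t = t * g t" using assms(4) by blast
  have "C2_on {0<..<\<alpha>} f" by (rule C2_on_subset[OF assms(3)]) auto
  then have g: "C2_on {0<..<\<alpha>} g" using fg by (rule C2_on_divide_id)
  have divided: "divdiff3 f (t 1) (t i) (t j) = t 1 * divdiff3 g (t 1) (t i) (t j) + divdiff2 g (t i) (t j)"
    if "t ` {1..n} \<subseteq> {0<..<\<alpha>}" "i \<in> {1..n}" "j \<in> {1..n}" for t i j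
    by (rule divdiff3_times_id[OF g fg]) (use subsetD[OF that(1) imageI] that(2,3) assms(2) in auto)
  have "n_convex_on n {0..<\<alpha>} f"
    if mono: "n_monotone_on n {0<..<\<alpha>} g" and conv: "n_convex_on n {0<..<\<alpha>} g"
  proof (rule n_convex_onI_kernel)
    fix c :: "nat \<Rightarrow> real" assume c: "\<And>i. i < n \<Longrightarrow> c i \<in> {0..<\<alpha>}"
    show "\<exists>D. \<forall>a\<in>{0..<\<alpha>}. pos_kernel n (interp_err f D c a)"
    proof (rule pos_kernel_endpoint[OF assms(3) _ c])
      fix c :: "nat \<Rightarrow> real" and a :: real
      assume c: "\<And>i. i < n \<Longrightarrow> c i \<in> {0<..<\<alpha>}" and inj: "inj_on c {..<n}" and a: "a \<in> {0<..<\<alpha>}"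
      have "pos_kernel n (loewner_kernel g c)"
        by (rule n_monotone_on_pos_kernel[OF mono g _ inj]) (rule c)
      moreover have "pos_kernel n (interp_err g (loewner_kernel g c) c a)"
        by (rule n_convex_on_pos_kernel[OF conv g _ inj _ a]) (use c assms(2) in auto)
      ultimately show "pos_kernel n (interp_err f (loewner_kernel f c) c a)"
        by (intro pos_kernel_times_id[OF g fg a]) (use c in auto)
    qed
  qed simp
  then show ?thesis using g divided by blast
qed

end
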